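(* Let $K\subset\overline{\mathbb R}$ be a non-empty compact set, $(a_n)_{n\in\mathbb N}$ a strictly increasing real sequence with $a_n<0$ for all $n\in\mathbb N$ or $a_n\ge0$ for all $n\in\mathbb N$, $\lim_{n\to\infty}a_n=0$ or $\lim_{n\to\infty}a_n=\infty$, and $\mathcal V:=(\exp(a_n\mu))_{n\in\mathbb N}$ where $\mu\colon\mathbb C\to[0,\infty)$, $\mu(z):=|\mathrm{Re}(z)|^\gamma$, for some $0<\gamma\le1$. If (i) $K\subset\mathbb R$, or $K\cap\{\pm\infty\}$ has no isolated points in $K$ (i.e. no point of $K\cap\{\pm\infty\}$ is an isolated point of $K$), or (ii) $K$ is arbitrary, $a_n<0$ for all $n\in\mathbb N$, $\lim_{n\to\infty}a_n=0$ and $\gamma=1$, then $\mathcal{OV}(\overline{\mathbb C}\setminus K)$ satisfies $(\Omega)$.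
   Context: $\mathbb N=\{1,2,\dots\}$; $\overline{\mathbb R}=\mathbb R\cup\{\pm\infty\}$ is the two-point compactification of $\mathbb R$. $d(M_0,M_1)$ is the Euclidean distance of subsets of $\mathbb C$, with value $\infty$ if one of them is empty. For compact $K\subset\overline{\mathbb R}$ and real $t\ge1$, $U_t(K)$ is the union of $\{z\in\mathbb C: d(\{z\},K\cap\mathbb C)<1/t\}$, of $(t,\infty)+i(-1/t,1/t)$ if $\infty\in K$, and of $(-\infty,-t)+i(-1/t,1/t)$ if $-\infty\in K$. $S_t(K):=(\mathbb C\setminus\overline{U_t(K)})\cap\{z:|\mathrm{Im}\,z|<t\}$ for $t>1$ and $S_1(K):=S_{3/2}(K)$ (closures and complements in $\mathbb C$). $\mathbb C\setminus K$ means $\mathbb C\setminus(K\cap\mathbb C)$. With $\nu_n:=\exp(a_n\mu)$, $\mathcal{OV}(\overline{\mathbb C}\setminus K)$ is the Fréchet space of holomorphic $F\colon\mathbb C\setminus K\to\mathbb C$ with $|F|_{K,n}:=\sup_{z\in S_n(K)}|F(z)|\nu_n(z)<\infty$ for all $n\in\mathbb N$, with the topology given by these seminorms. A Fréchet space $F$ with increasing fundamental system of seminorms $(|||\cdot|||_k)_{k\in\mathbb N}$ satisfies $(\Omega)$ if $\forall p\in\mathbb N\ \exists q\in\mathbb N\ \forall k\in\mathbb N\ \exists n\in\mathbb N, C>0\ \forall r>0:\ U_q\subset Cr^nU_k+\frac1rU_p$, where $U_k:=\{x\in F: |||x|||_k\le1\}$. *)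

theory Defs
  imports "HOL-Complex_Analysis.Complex_Analysis"
begin

text \<open>The compactification of the real line by two points is the type \<open>ereal\<close>; its order topology is
  the topology meant. All sequences and seminorm systems are indexed by the integers \<open>\<ge> 1\<close>; the value
  at index \<open>0\<close> is irrelevant.\<close>

definition finite_part :: "ereal set \<Rightarrow> complex set" where
  "finite_part K = complex_of_real ` {x. ereal x \<in> K}"

text \<open>Unlike the library's \<open>setdist\<close>, this is \<open>\<infinity>\<close> if one of the sets is empty.\<close>

definition eucl_dist :: "complex set \<Rightarrow> complex set \<Rightarrow> ereal" where
  "eucl_dist M0 M1 = (INF z\<in>M0. INF w\<in>M1. ereal (dist z w))"

definition U_nbhd :: "ereal set \<Rightarrow> real \<Rightarrow> complex set" where
  "U_nbhd K t =
     {z. eucl_dist {z} (finite_part K) < ereal (1 / t)} \<union>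
     (if \<infinity> \<in> K then {z. t < Re z \<and> - (1 / t) < Im z \<and> Im z < 1 / t} else {}) \<union>
     (if - \<infinity> \<in> K then {z. Re z < - t \<and> - (1 / t) < Im z \<and> Im z < 1 / t} else {})"

definition S_set :: "ereal set \<Rightarrow> real \<Rightarrow> complex set" where
  "S_set K t =
     (let s = (if t = 1 then 3 / 2 else t)
      in (- closure (U_nbhd K s)) \<inter> {z. \<bar>Im z\<bar> < s})"

definition mu :: "real \<Rightarrow> complex \<Rightarrow> real" where
  "mu \<gamma> z = \<bar>Re z\<bar> powr \<gamma>"

definition exp_weights :: "(nat \<Rightarrow> real) \<Rightarrow> (complex \<Rightarrow> real) \<Rightarrow> nat \<Rightarrow> complex \<Rightarrow> real" where
  "exp_weights a m n z = exp (a n * m z)"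

definition OV_seminorm ::
    "ereal set \<Rightarrow> (nat \<Rightarrow> complex \<Rightarrow> real) \<Rightarrow> nat \<Rightarrow> (complex \<Rightarrow> complex) \<Rightarrow> real" where
  "OV_seminorm K \<nu> n F = (SUP z\<in>S_set K (real n). cmod (F z) * \<nu> n z)"

text \<open>The carrier. Functions on the complement of \<open>K\<close> are represented by total functions that are \<open>0\<close>
  on the finite part of \<open>K\<close>, which makes the representative unique and keeps the carrier closed under
  pointwise addition and scaling. Boundedness is required explicitly because the real
  supremum in \<open>OV_seminorm\<close> is unspecified on unbounded sets.\<close>

definition OV_space ::
    "ereal set \<Rightarrow> (nat \<Rightarrow> complex \<Rightarrow> real) \<Rightarrow> (complex \<Rightarrow> complex) set" where
  "OV_space K \<nu> =
     {F. F holomorphic_on (- finite_part K) \<and>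
         (\<forall>z\<in>finite_part K. F z = 0) \<and>
         (\<forall>n\<ge>1. bdd_above ((\<lambda>z. cmod (F z) * \<nu> n z) ` S_set K (real n)))}"

definition seminorm_ball ::
    "('a \<Rightarrow> 'b) set \<Rightarrow> (nat \<Rightarrow> ('a \<Rightarrow> 'b) \<Rightarrow> real) \<Rightarrow> nat \<Rightarrow> ('a \<Rightarrow> 'b) set" where
  "seminorm_ball X p k = {f \<in> X. p k f \<le> 1}"

text \<open>Property \<open>(\<Omega>)\<close> for a Frechet space of functions with carrier \<open>X\<close>, pointwise operations, and
  increasing fundamental system of seminorms \<open>p\<close>.\<close>

definition property_Omega ::
    "('a \<Rightarrow> 'b::real_vector) set \<Rightarrow> (nat \<Rightarrow> ('a \<Rightarrow> 'b) \<Rightarrow> real) \<Rightarrow> bool" where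
  "property_Omega X p \<longleftrightarrow>
     (\<forall>i\<ge>1. \<exists>q\<ge>1. \<forall>k\<ge>1. \<exists>n\<ge>1. \<exists>C>0. \<forall>r>0.
        seminorm_ball X p q \<subseteq>
          {\<lambda>z. (C * r ^ n) *\<^sub>R f z + (1 / r) *\<^sub>R g z | f g.
             f \<in> seminorm_ball X p k \<and> g \<in> seminorm_ball X p i})"

text \<open>The seminorms of \<open>OV_space\<close> are increasing, as \<open>property_Omega\<close> presupposes.\<close>

lemma U_nbhd_antimono:
  assumes "0 < s" "s \<le> t"
  shows "U_nbhd K t \<subseteq> U_nbhd K s"
proof -
  have le: "1 / t \<le> 1 / s" using assms by (simp add: frac_le)
  then have "\<And>x::ereal. x < ereal (1 / t) \<Longrightarrow> x < ereal (1 / s)"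
    by (meson ereal_less_eq(3) less_le_trans)
  then show ?thesis using le assms by (auto simp: U_nbhd_def)
qed

lemma S_set_mono:
  assumes "1 \<le> m" "m \<le> n"
  shows "S_set K (real m) \<subseteq> S_set K (real n)"
proof -
  define g where "g = (\<lambda>t::real. if t = 1 then 3 / 2 else t)"
  have g: "0 < g (real m)" "g (real m) \<le> g (real n)"
    using assms by (auto simp: g_def)
  have "closure (U_nbhd K (g (real n))) \<subseteq> closure (U_nbhd K (g (real m)))"
    by (intro closure_mono U_nbhd_antimono g)
  moreover have "S_set K t = (- closure (U_nbhd K (g t))) \<inter> {z. \<bar>Im z\<bar> < g t}" for t
    unfolding S_set_def Let_def g_def ..
  ultimately show ?thesis using g by auto
qed

lemma U_nbhd_subset_strip:
  "U_nbhd K t \<subseteq> {z. \<bar>Im z\<bar> \<le> 1 / t}"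
proof -
  have "\<bar>Im z\<bar> \<le> 1 / t" if d: "eucl_dist {z} (finite_part K) < ereal (1 / t)" for z
  proof -
    from d obtain x where "dist z (complex_of_real x) < 1 / t"
      by (auto simp: eucl_dist_def finite_part_def INF_less_iff)
    moreover have "\<bar>Im z\<bar> \<le> dist z (complex_of_real x)"
      using abs_Im_le_cmod[of "z - complex_of_real x"] by (simp add: dist_norm)
    ultimately show ?thesis by simp
  qed
  then show ?thesis by (auto simp: U_nbhd_def)
qed

lemma S_set_nonempty:
  assumes "1 \<le> n"
  shows "S_set K (real n) \<noteq> {}"
proof -
  define s :: real where "s = (if real n = 1 then 3 / 2 else real n)"
  have s: "3 / 2 \<le> s" using assms by (auto simp: s_def)
  have "closed {z. \<bar>Im z\<bar> \<le> 1 / s}"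
    by (intro closed_Collect_le continuous_intros)
  then have "closure (U_nbhd K s) \<subseteq> {z. \<bar>Im z\<bar> \<le> 1 / s}"
    by (intro closure_minimal U_nbhd_subset_strip)
  moreover have "1 / s < 1" using s by simp
  ultimately have "\<i> \<in> (- closure (U_nbhd K s)) \<inter> {z. \<bar>Im z\<bar> < s}"
    using s by auto
  then show ?thesis unfolding S_set_def Let_def s_def[symmetric] by blast
qed

lemma OV_seminorm_mono:
  assumes a: "strict_mono_on {1..} a" and m: "\<And>z. 0 \<le> m z"
    and jk: "1 \<le> j" "j \<le> k" and F: "F \<in> OV_space K (exp_weights a m)"
  shows "OV_seminorm K (exp_weights a m) j F \<le> OV_seminorm K (exp_weights a m) k F"
  unfolding OV_seminorm_def
proof (rule cSUP_mono)
  show "S_set K (real j) \<noteq> {}" using S_set_nonempty jk by blast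
  show "bdd_above ((\<lambda>z. cmod (F z) * exp_weights a m k z) ` S_set K (real k))"
    using F jk by (auto simp: OV_space_def)
  have "a j \<le> a k"
    using strict_mono_on_leD[OF a] jk by auto
  then show "\<exists>w\<in>S_set K (real k). cmod (F z) * exp_weights a m j z \<le> cmod (F w) * exp_weights a m k w"
    if "z \<in> S_set K (real j)" for z
    using S_set_mono[OF jk] that m
    by (intro bexI[of _ z]) (auto simp: exp_weights_def intro!: mult_left_mono mult_right_mono)
qed

end

(*
Let F be bounded on S_q for a large q depending on p. Cutting the plane into narrow columns, Cauchy's
formula writes F on S_p as a sum of integrals over edges e that lie in S_q at a fixed distance from
S_p; a Gaussian factor exp (-(w - z)^2) makes the sum converge and localizes all weights. Near each
edge e there is a peak function Phi_e, holomorphic off K, with |Phi_e| >= 1 on e, |Phi_e| <= 2/3 on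
S_p and |Phi_e| <= B_m on every S_m, uniformly in e: it is a multiple of 1/(z - b) with b in K, or
exp (+-i z - T), or, near an infinite point of K, an entire function close to 1/(z - b) and bounded
off every thin half strip, obtained by pushing the pole b along the real axis to infinity.
Replacing the Cauchy kernel by (1 - (Phi_e(z) / Phi_e(w))^N) / (w - z), which is holomorphic across
e, and keeping only the columns on which |Re w|^gamma <= const * ln r yields a function f, holomorphic
off K. With N ~ ln r the error F - f is O(1/r) on S_p, whereas f grows at most like a power of r on
every S_m.
*)
theory Submission
  imports Defs
begin

subsection \<open>Divided differences and integrals with holomorphic parameters\<close>

text \<open>The index q may depend on p alone, so the set on which F is controlled is fixed before k
  is known, and all of k must go into the exponent of r. Two independent gains give the factor 1/r:
  the power (2/3)^N of the peaks on the kept columns, and on the dropped ones the weight ratio exp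
  ((a_p - a_q) mu), which decays because a is strictly increasing. The corresponding losses B_m^N
  and exp ((a_m - a_q) mu) are then powers of r. Since \<gamma> \<le> 1, mu varies at most linearly,
  so the Gaussian beats any change of weight between w and z. The obstacle is an infinite point of K
  with no finite points of K nearby. There 1/(z - b) would have its pole outside K, while the
  exponentials that peak on the outermost edges do not peak near the real axis. An entire substitute
  is needed, with bounds on each S_m that are uniform in b; a single function, translated and
  reflected, supplies all of them.\<close>

definition divided_difference :: "(complex \<Rightarrow> complex) \<Rightarrow> complex \<Rightarrow> complex \<Rightarrow> complex" where
  "divided_difference f z w = (if w = z then deriv f z else (f w - f z) / (w - z))"

lemma divided_difference_commute: "divided_difference f z w = divided_difference f w z"
  by (auto simp: divided_difference_def) (metis minus_diff_eq minus_divide_divide)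

lemma holomorphic_divided_difference:
  assumes "f holomorphic_on U" "open U" "w \<in> U"
  shows "(\<lambda>z. divided_difference f z w) holomorphic_on U"
proof -
  have "(\<lambda>z. if z = w then deriv f w else (f z - f w) / (z - w)) holomorphic_on U"
    using assms by (intro pole_lemma) (auto simp: interior_open)
  moreover have "divided_difference f z w =
      (if z = w then deriv f w else (f z - f w) / (z - w))" for z
    using divided_difference_commute[of f z w] by (auto simp: divided_difference_def)
  ultimately show ?thesis by simp
qed

text \<open>At a diagonal point the difference from \<open>deriv f x\<close> is estimated by the
  mean value inequality for \<open>f v - deriv f x * v\<close> on a ball where
  \<open>deriv f\<close> stays within r/2 of \<open>deriv f x\<close>. Continuity in both variables
  jointly is what the parameter integrals over edges require.\<close>

lemma continuous_on_divided_difference: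
  assumes f: "f holomorphic_on U" and U: "open U"
  shows "continuous_on (U \<times> U) (\<lambda>(z, w). divided_difference f z w)"
proof -
  have cf: "continuous_on U f" by (rule holomorphic_on_imp_continuous_on[OF f])
  have "isCont (\<lambda>(z, w). divided_difference f z w) (x, y)" if xy: "x \<in> U" "y \<in> U" for x y
  proof (cases "x = y")
    case False
    have op: "open {p::complex \<times> complex. fst p \<noteq> snd p}"
      by (intro open_Collect_neq continuous_intros)
    have "isCont f x" "isCont f y"
      using cf U xy continuous_on_eq_continuous_at by blast+
    then have "isCont (\<lambda>p. (f (snd p) - f (fst p)) / (snd p - fst p)) (x, y)"
      using False by (intro continuous_intros isCont_o2[of "(x,y)" snd f] isCont_o2[of "(x,y)" fst f]) auto
    moreover have "eventually (\<lambda>p. (f (snd p) - f (fst p)) / (snd p - fst p) =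
        (case p of (z, w) \<Rightarrow> divided_difference f z w)) (nhds (x, y))"
      using eventually_nhds_in_open[OF op, of "(x, y)"] False
      by (auto elim!: eventually_mono simp: divided_difference_def split: prod.splits)
    from isCont_cong[OF this] calculation show ?thesis by simp
  next
    case True
    have lim: "((\<lambda>(z, w). divided_difference f z w) \<longlongrightarrow> deriv f x) (at (x, x))"
    proof (rule LIM_I)
      fix r :: real assume r: "r > 0"
      have "isCont (deriv f) x"
        using holomorphic_on_imp_continuous_on[OF holomorphic_deriv[OF f U]] U xy
        by (simp add: continuous_on_eq_continuous_at)
      then obtain d1 where d1: "d1 > 0" "\<And>z. dist z x < d1 \<Longrightarrow> dist (deriv f z) (deriv f x) < r / 2"
        using r unfolding continuous_at_eps_delta by (metis half_gt_zero)
      obtain d2 where d2: "d2 > 0" "ball x d2 \<subseteq> U" using U xy openE by blast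
      define d where "d = min d1 d2"
      have d: "d > 0" using d1 d2 by (simp add: d_def)
      have B: "ball x d \<subseteq> U" using d2 by (auto simp: d_def)
      have le: "norm (divided_difference f z w - deriv f x) \<le> r / 2"
        if "z \<in> ball x d" "w \<in> ball x d" for z w
      proof (cases "w = z")
        case True
        then show ?thesis
          using that d1(2)[of z] by (auto simp: divided_difference_def d_def dist_norm norm_minus_commute)
      next
        case False
        have "norm ((f w - deriv f x * w) - (f z - deriv f x * z)) \<le> (r / 2) * norm (w - z)"
        proof (rule field_differentiable_bound[of "ball x d"])
          fix u assume u: "u \<in> ball x d"
          then have "(f has_field_derivative deriv f u) (at u)"
            using B f U by (meson holomorphic_derivI subsetD)
          then show "((\<lambda>v. f v - deriv f x * v) has_field_derivative (deriv f u - deriv f x)) (at u within ball x d)"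
            by (rule DERIV_diff[OF has_field_derivative_at_within DERIV_cmult_Id])
          show "norm (deriv f u - deriv f x) \<le> r / 2"
            using d1(2)[of u] u by (auto simp: d_def dist_norm norm_minus_commute)
        qed (use that in auto)
        moreover have "divided_difference f z w - deriv f x =
            ((f w - deriv f x * w) - (f z - deriv f x * z)) / (w - z)"
          using False by (simp add: divided_difference_def field_simps)
        ultimately show ?thesis using False by (simp only: norm_divide) (simp add: pos_divide_le_eq)
      qed
      show "\<exists>s>0. \<forall>p. p \<noteq> (x, x) \<and> norm (p - (x, x)) < s \<longrightarrow>
          norm ((case p of (z, w) \<Rightarrow> divided_difference f z w) - deriv f x) < r"
      proof (intro exI[of _ d] conjI allI impI)
        fix p assume p: "p \<noteq> (x, x) \<and> norm (p - (x, x)) < d"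
        obtain z w where pzw: "p = (z, w)" by fastforce
        have "norm (z - x) < d" "norm (w - x) < d"
          using p norm_fst_le[of "z - x" "w - x"] norm_snd_le[of "w - x" "z - x"] unfolding pzw by auto
        then have "norm (divided_difference f z w - deriv f x) \<le> r / 2"
          by (intro le) (auto simp: dist_norm norm_minus_commute)
        then show "norm ((case p of (z, w) \<Rightarrow> divided_difference f z w) - deriv f x) < r"
          using r by (simp add: pzw)
      qed (rule d)
    qed
    show ?thesis using lim True by (simp add: isCont_def divided_difference_def)
  qed
  then show ?thesis by (intro continuous_at_imp_continuous_on) auto
qed

text \<open>Only points near \<open>w\<close> make the quotient delicate. On the circle of radius
  \<open>\<rho>\<close> the denominator has modulus \<open>\<rho>\<close>, and the maximum modulus
  principle carries that bound into the disc. Hence z may come arbitrarily close to an edge.\<close>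

lemma cmod_divided_difference_le:
  assumes f: "f holomorphic_on U" and U: "open U" and w: "cball w \<rho> \<subseteq> U" and \<rho>: "\<rho> > 0"
    and z: "z \<in> V" and V: "cball w \<rho> \<subseteq> V" and M: "\<And>v. v \<in> V \<Longrightarrow> cmod (f v) \<le> M"
  shows "cmod (divided_difference f z w) \<le> (cmod (f w) + M) / \<rho>"
proof -
  have far: "cmod (divided_difference f v w) \<le> (cmod (f w) + M) / \<rho>"
    if v: "v \<in> V" "dist w v \<ge> \<rho>" for v
  proof -
    have "cmod (f w - f v) \<le> cmod (f w) + M"
      using norm_triangle_ineq4[of "f w" "f v"] M[OF v(1)] by linarith
    moreover have "cmod (w - v) \<ge> \<rho>" "w \<noteq> v" using v \<rho> by (auto simp: dist_norm)
    ultimately show ?thesis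
      using \<rho> by (auto simp: divided_difference_def norm_divide intro!: frac_le order_trans[OF norm_ge_zero])
  qed
  show ?thesis
  proof (cases "dist w z \<ge> \<rho>")
    case True
    then show ?thesis using far z by blast
  next
    case False
    have w0: "w \<in> U" using w \<rho> by auto
    have hol: "(\<lambda>v. divided_difference f v w) holomorphic_on U"
      by (rule holomorphic_divided_difference[OF f U w0])
    show ?thesis
    proof (rule maximum_modulus_frontier[of "\<lambda>v. divided_difference f v w" "cball w \<rho>"])
      show "(\<lambda>v. divided_difference f v w) holomorphic_on interior (cball w \<rho>)"
        using hol w interior_subset by (blast intro: holomorphic_on_subset)
      show "continuous_on (closure (cball w \<rho>)) (\<lambda>v. divided_difference f v w)"
        using holomorphic_on_imp_continuous_on[OF hol] w by (auto intro: continuous_on_subset)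
      show "cmod (divided_difference f v w) \<le> (cmod (f w) + M) / \<rho>" if "v \<in> frontier (cball w \<rho>)" for v
      proof -
        have "dist w v = \<rho>" using that \<rho> by (auto simp: frontier_cball)
        then show ?thesis using V by (intro far) auto
      qed
    qed (use False in auto)
  qed
qed

text \<open>Morera's theorem: the integral over a triangle in z is interchanged with the one over
  the segment, and for each fixed w the inner triangle integral vanishes by Cauchy's
  theorem.\<close>

lemma holomorphic_on_contour_integral_linepath:
  fixes k :: "complex \<Rightarrow> complex \<Rightarrow> complex"
  assumes U: "open U"
    and cont: "continuous_on (U \<times> closed_segment a b) (\<lambda>(z, w). k z w)"
    and hol: "\<And>w. w \<in> closed_segment a b \<Longrightarrow> (\<lambda>z. k z w) holomorphic_on U"
  shows "(\<lambda>z. contour_integral (linepath a b) (k z)) holomorphic_on U"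
proof -
  have conth: "continuous_on U (\<lambda>z. contour_integral (linepath a b) (k z))"
  proof -
    have lp: "continuous_on A (\<lambda>p. linepath a b (snd p))" for A :: "(complex \<times> real) set"
      unfolding linepath_def by (intro continuous_intros)
    have "continuous_on (U \<times> {0..1::real}) (\<lambda>(z, t). k z (linepath a b t) * (b - a))"
    proof -
      have "continuous_on (U \<times> {0..1::real}) ((\<lambda>(z, w). k z w) \<circ> (\<lambda>p. (fst p, linepath a b (snd p))))"
        by (intro continuous_on_compose continuous_intros lp continuous_on_subset[OF cont])
          (auto simp: linepath_in_path)
      then have "continuous_on (U \<times> {0..1::real}) (\<lambda>p. k (fst p) (linepath a b (snd p)) * (b - a))"
        by (intro continuous_intros) (simp add: o_def)
      then show ?thesis by (simp add: case_prod_beta')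
    qed
    then have "continuous_on U (\<lambda>z. integral (cbox 0 1) (\<lambda>t::real. k z (linepath a b t) * (b - a)))"
      by (intro integral_continuous_on_param) simp
    then show ?thesis by (simp add: contour_integral_integral)
  qed
  have "(\<lambda>z. contour_integral (linepath a b) (k z)) analytic_on U"
  proof (rule Morera_triangle[OF conth U], intro impI)
    fix x y z assume hull: "convex hull {x, y, z} \<subseteq> U"
    have segs: "closed_segment x y \<subseteq> U" "closed_segment y z \<subseteq> U" "closed_segment z x \<subseteq> U"
      using hull segments_subset_convex_hull(1,3,5)[where a = x and b = y and c = z] by (meson order_trans)+
    have sw: "contour_integral (linepath u v) (\<lambda>z. contour_integral (linepath a b) (k z)) =
        contour_integral (linepath a b) (\<lambda>w. contour_integral (linepath u v) (\<lambda>z. k z w))"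
      if "closed_segment u v \<subseteq> U" for u v
      using that by (intro contour_integral_swap continuous_on_subset[OF cont]) auto
    have lp: "continuous_on A (\<lambda>p. linepath u v (snd p))" for u v and A :: "(complex \<times> real) set"
      unfolding linepath_def by (intro continuous_intros)
    have ci: "(\<lambda>w. contour_integral (linepath u v) (\<lambda>z. k z w)) contour_integrable_on linepath a b"
      if "closed_segment u v \<subseteq> U" for u v
    proof (rule contour_integrable_continuous_linepath)
      have "continuous_on (closed_segment a b \<times> {0..1::real}) ((\<lambda>(z, w). k z w) \<circ> (\<lambda>p. (linepath u v (snd p), fst p)))"
        using that by (intro continuous_on_compose continuous_intros lp continuous_on_subset[OF cont])
          (auto simp: linepath_in_path subset_iff)
      then have "continuous_on (closed_segment a b \<times> {0..1::real}) (\<lambda>p. k (linepath u v (snd p)) (fst p) * (v - u))"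
        by (intro continuous_intros) (simp add: o_def)
      then have "continuous_on (closed_segment a b) (\<lambda>w. integral (cbox 0 1) (\<lambda>t::real. k (linepath u v t) w * (v - u)))"
        by (intro integral_continuous_on_param) (simp add: case_prod_beta')
      then show "continuous_on (closed_segment a b) (\<lambda>w. contour_integral (linepath u v) (\<lambda>z. k z w))"
        by (simp add: contour_integral_integral)
    qed
    have zero: "contour_integral (linepath x y) (\<lambda>z. k z w) + contour_integral (linepath y z) (\<lambda>z. k z w)
        + contour_integral (linepath z x) (\<lambda>z. k z w) = 0" if w: "w \<in> closed_segment a b" for w
    proof -
      have int: "(\<lambda>z. k z w) contour_integrable_on linepath u v" if "closed_segment u v \<subseteq> U" for u v
        by (rule contour_integrable_continuous_linepath[OF continuous_on_subset
            [OF holomorphic_on_imp_continuous_on[OF hol[OF w]] that]])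
      have "contour_integral (linepath x y +++ linepath y z +++ linepath z x) (\<lambda>z. k z w) = 0"
        by (rule contour_integral_unique[OF Cauchy_theorem_triangle])
          (rule holomorphic_on_subset[OF hol[OF w] hull])
      then show ?thesis using int segs by (simp add: add.assoc)
    qed
    have "contour_integral (linepath x y) (\<lambda>z. contour_integral (linepath a b) (k z))
        + contour_integral (linepath y z) (\<lambda>z. contour_integral (linepath a b) (k z))
        + contour_integral (linepath z x) (\<lambda>z. contour_integral (linepath a b) (k z))
      = contour_integral (linepath a b) (\<lambda>w. contour_integral (linepath x y) (\<lambda>z. k z w)
          + contour_integral (linepath y z) (\<lambda>z. k z w) + contour_integral (linepath z x) (\<lambda>z. k z w))"
      using segs by (simp add: sw contour_integral_add ci contour_integrable_add)
    also have "\<dots> = contour_integral (linepath a b) (\<lambda>w. 0)"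
      by (rule contour_integral_eq) (use zero in auto)
    finally show "contour_integral (linepath x y) (\<lambda>z. contour_integral (linepath a b) (k z))
        + contour_integral (linepath y z) (\<lambda>z. contour_integral (linepath a b) (k z))
        + contour_integral (linepath z x) (\<lambda>z. contour_integral (linepath a b) (k z)) = 0"
      by simp
  qed
  then show ?thesis by (rule analytic_imp_holomorphic)
qed

subsection \<open>Pushing poles to infinity\<close>

text \<open>With u = 1/(z - s') and d = s - s', 1/(z - s) = u/(1 - u d) is a geometric series,
  uniformly convergent for |u d| \<le> 1/2. \<open>Q'\<close> is \<open>Q\<close> composed with a
  partial sum, again a polynomial in the reciprocal, so the step can be iterated.\<close>

lemma pole_shift:
  fixes s s' :: complex and e :: real
  assumes ne: "s \<noteq> s'" and e: "e > 0"
  shows "\<exists>Q'. \<forall>z. 2 * dist s s' \<le> dist z s' \<longrightarrow>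
           dist (poly Q (1 / (z - s))) (poly Q' (1 / (z - s'))) \<le> e"
proof -
  define d where "d = s - s'"
  have d0: "d \<noteq> 0" "cmod d > 0" using ne by (auto simp: d_def)
  define t :: "nat \<Rightarrow> complex poly" where "t n = [:0, 1:] * (\<Sum>k<n. [:0, d:] ^ k)" for n
  \<comment> \<open>Both 1/(z - s) and its approximant lie in this disc, so uniform continuity of
    \<open>Q\<close> on it turns closeness of the arguments into closeness of the values.\<close>
  define X where "X = cball (0::complex) (1 / cmod d)"
  have "uniformly_continuous_on X (poly Q)"
    unfolding X_def by (intro compact_uniformly_continuous continuous_intros) auto
  then obtain \<eta> where \<eta>: "\<eta> > 0"
    "\<And>x y. x \<in> X \<Longrightarrow> y \<in> X \<Longrightarrow> dist y x < \<eta> \<Longrightarrow> dist (poly Q y) (poly Q x) < e"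
    using e unfolding uniformly_continuous_on_def by metis
  obtain n where n: "(1 / 2) ^ n < \<eta> * cmod d"
    using real_arch_pow_inv[of "\<eta> * cmod d" "1 / 2"] \<eta> d0 by auto
  show ?thesis
  proof (intro exI[of _ "pcompose Q (t n)"] allI impI)
    fix z assume z: "2 * dist s s' \<le> dist z s'"
    define u where "u = 1 / (z - s')"
    have zs': "z \<noteq> s'" using z ne by auto
    have zs: "z \<noteq> s" using z ne by auto
    have cd: "2 * cmod d \<le> cmod (z - s')" using z by (simp add: d_def dist_norm)
    have ud: "cmod (u * d) \<le> 1 / 2" using cd zs' d0 by (simp add: u_def norm_divide divide_simps)
    have ub: "cmod u \<le> 1 / (2 * cmod d)" using cd zs' d0 by (simp add: u_def norm_divide divide_simps)
    have ne1: "1 - u * d \<noteq> 0" using ud by auto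
    have lower: "1 / 2 \<le> cmod (1 - u * d)" using norm_triangle_ineq2[of 1 "u * d"] ud by simp
    have h: "1 / (z - s) = u / (1 - u * d)"
      using zs zs' ne1 by (simp add: u_def d_def divide_simps)
    have tp: "poly (t n) u = u * (1 - (u * d) ^ n) / (1 - u * d)"
      using ne1 by (simp add: t_def poly_sum sum_gp_strict)
    have inX: "1 / (z - s) \<in> X"
    proof -
      have "cmod (u / (1 - u * d)) \<le> (1 / (2 * cmod d)) / (1 / 2)"
        using ub lower by (simp only: norm_divide) (intro frac_le; simp)
      then show ?thesis by (simp add: h X_def)
    qed
    have diff: "1 / (z - s) - poly (t n) u = (u * (u * d) ^ n) / (1 - u * d)"
      using ne1 by (simp add: h tp divide_simps) (simp add: algebra_simps)
    have "cmod (1 / (z - s) - poly (t n) u) \<le> ((1 / (2 * cmod d)) * (1 / 2) ^ n) / (1 / 2)"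
      unfolding diff norm_divide norm_mult norm_power[of "u * d"] using ub lower ud
      by (intro frac_le mult_mono power_mono) (auto simp: norm_mult)
    then have dn: "cmod (1 / (z - s) - poly (t n) u) \<le> (1 / 2) ^ n / cmod d" by simp
    have dl: "dist (1 / (z - s)) (poly (t n) u) < \<eta>"
    proof -
      have "(1 / 2) ^ n / cmod d < \<eta>" using n d0(2) by (simp only: pos_divide_less_eq)
      then show ?thesis using dn unfolding dist_norm by linarith
    qed
    have tX: "poly (t n) u \<in> X"
    proof -
      have "cmod (\<Sum>k<n. (u * d) ^ k) \<le> (\<Sum>k<n. (1 / 2) ^ k)"
        using ud by (intro sum_norm_le) (auto simp: norm_power intro!: power_mono)
      also have "\<dots> \<le> 2" by (simp add: sum_gp_strict)
      finally have "cmod u * cmod (\<Sum>k<n. (u * d) ^ k) \<le> (1 / (2 * cmod d)) * 2"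
        using ub by (intro mult_mono) auto
      then show ?thesis by (simp add: t_def X_def poly_sum norm_mult)
    qed
    have "dist (poly Q (1 / (z - s))) (poly Q (poly (t n) u)) < e"
      using \<eta>(2)[OF tX inX dl] .
    then show "dist (poly Q (1 / (z - s))) (poly (pcompose Q (t n)) (1 / (z - s'))) \<le> e"
      by (simp add: poly_pcompose u_def)
  qed
qed

text \<open>The poles of the rational functions \<open>R j\<close> run to infinity along the positive axis in steps that
  shrink to zero but have a divergent sum, so the exceptional discs end up in every half strip.\<close>

lemma entire_approx_inverse_off_half_strip:
  fixes \<delta> e :: real
  assumes \<delta>: "\<delta> > 0" and e: "e > 0"
  shows "\<exists>\<Psi>. \<Psi> holomorphic_on UNIV \<and>
    (\<forall>z. Re z \<le> - \<delta> \<or> \<delta> \<le> \<bar>Im z\<bar> \<longrightarrow> cmod (\<Psi> z - 1 / z) \<le> e) \<and>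
    (\<forall>x. \<forall>\<eta>>0. \<exists>B. \<forall>z. Re z \<le> x \<or> \<eta> \<le> \<bar>Im z\<bar> \<longrightarrow> cmod (\<Psi> z) \<le> B)"
proof -
  \<comment> \<open>The factor \<open>\<delta> / 2\<close> makes the radii \<open>2 * d j\<close> of
    the exceptional discs at most \<open>\<delta>\<close>. Their centres s_(j+1) are nonnegative, so
    every open disc avoids the region Re z \<le> - \<delta> or |Im z| \<ge> \<delta>.\<close>
  define d :: "nat \<Rightarrow> real" where "d j = (\<delta> / 2) * inverse (real (Suc j))" for j
  define s :: "nat \<Rightarrow> real" where "s j = (\<Sum>i<j. d i)" for j
  have d: "d j > 0" "2 * d j \<le> \<delta>" for j using \<delta> by (auto simp: d_def divide_simps)
  have sS: "s (Suc j) = s j + d j" for j by (simp add: s_def)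
  have s0: "s 0 = 0" by (simp add: s_def)
  have s_mono: "s i \<le> s j" if "i \<le> j" for i j
    unfolding s_def using that d(1) by (intro sum_mono2) (auto simp: less_imp_le)
  have s_nn: "0 \<le> s j" for j using s_mono[of 0 j] s0 by simp
  have "\<not> summable (\<lambda>j. inverse (real (Suc j)))"
    using not_summable_harmonic[where 'a = real] summable_Suc_iff[of "\<lambda>n. inverse (real n)"] by simp
  moreover have "(\<lambda>j. inverse (real (Suc j))) = (\<lambda>j. (2 / \<delta>) * d j)" using \<delta> by (simp add: d_def fun_eq_iff)
  ultimately have ns: "\<not> summable d" using summable_mult[of d "2 / \<delta>"] by metis
  have s_unb: "\<exists>j. x \<le> s j" for x
  proof (rule ccontr)
    assume "\<nexists>j. x \<le> s j"
    then have "s j \<le> x" for j by (meson linear)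
    then have "(\<Sum>i\<le>n. d i) \<le> x" for n by (metis s_def lessThan_Suc_atMost)
    then have "summable d"
      using d(1) by (intro bounded_imp_summable[of d x]) (auto simp: less_imp_le)
    with ns show False by simp
  qed
  \<comment> \<open>The tolerances from stage J on sum to e/2^J, hence to e in total.\<close>
  have "\<forall>j Q. \<exists>Q'. \<forall>z. 2 * dist (complex_of_real (s j)) (complex_of_real (s (Suc j))) \<le> dist z (complex_of_real (s (Suc j))) \<longrightarrow>
      dist (poly Q (1 / (z - complex_of_real (s j)))) (poly Q' (1 / (z - complex_of_real (s (Suc j))))) \<le> e * (1 / 2) ^ Suc j"
    using e less_imp_neq[OF d(1)] by (intro allI pole_shift) (simp_all add: sS)
  then obtain nxt where nxt: "\<And>j Q z. 2 * dist (complex_of_real (s j)) (complex_of_real (s (Suc j))) \<le> dist z (complex_of_real (s (Suc j))) \<Longrightarrow>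
      dist (poly Q (1 / (z - complex_of_real (s j)))) (poly (nxt j Q) (1 / (z - complex_of_real (s (Suc j))))) \<le> e * (1 / 2) ^ Suc j"
    by metis
  define Q where "Q = rec_nat [:0, 1:] nxt"
  define R where "R j z = poly (Q j) (1 / (z - complex_of_real (s j)))" for j z
  have R0: "R 0 z = 1 / z" for z by (simp add: R_def Q_def s0)
  have step: "dist (R j z) (R (Suc j) z) \<le> e * (1 / 2) ^ Suc j"
    if "2 * d j \<le> dist z (complex_of_real (s (Suc j)))" for j z
    using nxt[of j z "Q j"] that d(1)[of j]
    by (simp add: R_def Q_def sS dist_norm flip: of_real_add of_real_diff)
  \<comment> \<open>The points outside all exceptional discs from stage \<open>J\<close> on; there
    every later function stays within e/2^J of \<open>R J\<close>.\<close>
  define W where "W J = {z. \<forall>j\<ge>J. 2 * d j \<le> dist z (complex_of_real (s (Suc j)))}" for J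
  have RR: "dist (R J z) (R (J + n) z) \<le> e * (1 / 2) ^ J * (1 - (1 / 2) ^ n)" if "z \<in> W J" for z J n
  proof (induction n)
    case (Suc n)
    have "dist (R (J + n) z) (R (Suc (J + n)) z) \<le> e * (1 / 2) ^ Suc (J + n)"
      using that by (intro step) (auto simp: W_def)
    then have "dist (R J z) (R (J + Suc n) z) \<le> e * (1 / 2) ^ J * (1 - (1 / 2) ^ n) + e * (1 / 2) ^ Suc (J + n)"
      using Suc dist_triangle[of "R J z" "R (J + Suc n) z" "R (J + n) z"] by simp
    also have "\<dots> = e * (1 / 2) ^ J * (1 - (1 / 2) ^ Suc n)" by (simp add: power_add algebra_simps)
    finally show ?case .
  qed simp
  have RR': "dist (R J z) (R k z) \<le> e * (1 / 2) ^ J" if "z \<in> W J" "J \<le> k" for z J k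
  proof -
    have "e * (1 / 2) ^ J * (1 - (1 / 2) ^ (k - J)) \<le> e * (1 / 2) ^ J * 1"
      using e by (intro mult_left_mono) auto
    then show ?thesis using RR[OF that(1), of "k - J"] that(2) by simp
  qed
  \<comment> \<open>Either the centres have passed x + 1 + \<delta>, or the radii have dropped to at
    most \<eta>. The extra conclusion \<open>x + 1 \<le> s J\<close> keeps the pole of
    \<open>R J\<close> itself at distance 1 from the half plane Re z \<le> x.\<close>
  have in_W: "\<exists>J0. \<forall>J\<ge>J0. x + 1 \<le> s J \<and> (\<forall>z. Re z \<le> x \<or> \<eta> \<le> \<bar>Im z\<bar> \<longrightarrow> z \<in> W J)" if "\<eta> > 0" for x \<eta>
  proof -
    obtain j1 where j1: "x + 1 + \<delta> \<le> s j1" using s_unb by blast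
    obtain j2 :: nat where j2: "\<delta> / \<eta> < real j2" using reals_Archimedean2 by blast
    have "x + 1 \<le> s J \<and> (Re z \<le> x \<or> \<eta> \<le> \<bar>Im z\<bar> \<longrightarrow> z \<in> W J)" if J: "max j1 j2 \<le> J" for J z
    proof (intro conjI impI)
      show "x + 1 \<le> s J" using j1 s_mono[of j1 J] J \<delta> by simp
      assume z: "Re z \<le> x \<or> \<eta> \<le> \<bar>Im z\<bar>"
      show "z \<in> W J" unfolding W_def
      proof (intro CollectI allI impI)
        fix j assume j: "J \<le> j"
        have D: "\<bar>Re z - s (Suc j)\<bar> \<le> dist z (complex_of_real (s (Suc j)))"
          "\<bar>Im z\<bar> \<le> dist z (complex_of_real (s (Suc j)))"
          using abs_Re_le_cmod[of "z - complex_of_real (s (Suc j))"] abs_Im_le_cmod[of "z - complex_of_real (s (Suc j))"]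
          by (auto simp: dist_norm)
        from z show "2 * d j \<le> dist z (complex_of_real (s (Suc j)))"
        proof
          assume "Re z \<le> x"
          moreover have "x + 1 + \<delta> \<le> s (Suc j)" using j1 s_mono[of j1 "Suc j"] J j by simp
          ultimately show ?thesis using D(1) d(2)[of j] by linarith
        next
          assume "\<eta> \<le> \<bar>Im z\<bar>"
          moreover have "2 * d j \<le> \<eta>"
          proof -
            have "\<delta> / \<eta> \<le> real (Suc j)" using j2 J j by simp
            then show ?thesis using that \<open>\<eta> > 0\<close> by (simp add: d_def field_simps)
          qed
          ultimately show ?thesis using D(2) by linarith
        qed
      qed
    qed
    then show ?thesis by blast
  qed
  define \<Psi> where "\<Psi> z = lim (\<lambda>k. R k z)" for z
  have conv: "(\<lambda>k. R k z) \<longlonglongrightarrow> \<Psi> z" for z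
  proof -
    obtain J0 where J0: "\<And>J. J \<ge> J0 \<Longrightarrow> z \<in> W J" using in_W[of 1 "Re z"] by auto
    have "Cauchy (\<lambda>k. R k z)"
    proof (rule metric_CauchyI)
      fix r :: real assume r: "r > 0"
      obtain n where n: "(1 / 2) ^ n < r / (2 * e)" using real_arch_pow_inv[of "r / (2 * e)" "1 / 2"] r e by auto
      define M where "M = max J0 n"
      have "(1 / 2) ^ M \<le> (1 / 2 :: real) ^ n" by (intro power_decreasing) (auto simp: M_def)
      then have "e * (1 / 2) ^ M \<le> e * (1 / 2) ^ n" using e by (intro mult_left_mono) auto
      also have "\<dots> < e * (r / (2 * e))" using n e by (intro mult_strict_left_mono) auto
      finally have m: "e * (1 / 2) ^ M < r / 2" using e by simp
      have "dist (R i z) (R k z) < r" if "M \<le> i" "M \<le> k" for i k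
        using RR'[of z M i] RR'[of z M k] J0[of M] that m dist_triangle3[of "R i z" "R k z" "R M z"]
        by (simp add: M_def)
      then show "\<exists>M. \<forall>i\<ge>M. \<forall>k\<ge>M. dist (R i z) (R k z) < r" by blast
    qed
    then show ?thesis by (simp add: \<Psi>_def Cauchy_convergent_iff convergent_LIMSEQ_iff)
  qed
  have close: "dist (R J z) (\<Psi> z) \<le> e * (1 / 2) ^ J" if "z \<in> W J" for J z
  proof (rule Lim_bounded)
    show "(\<lambda>k. dist (R J z) (R k z)) \<longlonglongrightarrow> dist (R J z) (\<Psi> z)"
      by (intro tendsto_intros conv)
    show "\<forall>k\<ge>J. dist (R J z) (R k z) \<le> e * (1 / 2) ^ J" using RR'[OF that] by blast
  qed
  \<comment> \<open>On each disc about 0 a tail of the sequence has no poles and converges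
    uniformly.\<close>
  have hol: "\<Psi> holomorphic_on UNIV"
  proof -
    have "\<Psi> holomorphic_on ball 0 x" for x
    proof -
      obtain J0 where J0: "\<And>J. J \<ge> J0 \<Longrightarrow> x + 1 \<le> s J" "\<And>J z. J \<ge> J0 \<Longrightarrow> Re z \<le> x \<Longrightarrow> z \<in> W J"
        using in_W[of 1 x] by force
      have bW: "ball 0 x \<subseteq> W J" if "J \<ge> J0" for J
        using J0(2)[OF that] complex_Re_le_cmod by (meson dual_order.trans less_imp_le mem_ball_0 subsetI)
      show ?thesis
      proof (rule holomorphic_uniform_sequence[of _ "\<lambda>k. R (k + J0)"])
        show "R (n + J0) holomorphic_on ball 0 x" for n
        proof -
          have "z \<noteq> complex_of_real (s (n + J0))" if "z \<in> ball 0 x" for z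
            using J0(1)[of "n + J0"] that complex_Re_le_cmod[of z] by (auto simp: complex_eq_iff)
          then have "R (n + J0) field_differentiable (at z)" if "z \<in> ball 0 x" for z
            unfolding R_def field_differentiable_def using that
            by (intro exI) (auto intro!: derivative_eq_intros DERIV_chain2[OF poly_DERIV])
          then show ?thesis
            by (simp add: holomorphic_on_def field_differentiable_at_within)
        qed
        fix z :: complex assume "z \<in> ball 0 x"
        then obtain r where r: "r > 0" "cball z r \<subseteq> ball 0 x" using open_contains_cball open_ball by blast
        have "uniform_limit (cball z r) (\<lambda>k. R (k + J0)) \<Psi> sequentially"
        proof (rule uniform_limitI)
          fix \<epsilon> :: real assume "\<epsilon> > 0"
          then obtain n where n: "(1 / 2) ^ n < \<epsilon> / e" using real_arch_pow_inv[of "\<epsilon> / e" "1 / 2"] e by auto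
          have "dist (R (k + J0) y) (\<Psi> y) < \<epsilon>" if "n \<le> k" "y \<in> cball z r" for k y
          proof -
            have "(1 / 2) ^ (k + J0) \<le> (1 / 2 :: real) ^ n" using that by (intro power_decreasing) auto
            then have "e * (1 / 2) ^ (k + J0) \<le> e * (1 / 2) ^ n" using e by (intro mult_left_mono) auto
            also have "\<dots> < e * (\<epsilon> / e)" using n e by (intro mult_strict_left_mono) auto
            finally have "e * (1 / 2) ^ (k + J0) < \<epsilon>" using e by simp
            moreover have "y \<in> W (k + J0)" using bW[of "k + J0"] r(2) that(2) by auto
            ultimately show ?thesis using close[of y "k + J0"] by linarith
          qed
          then show "\<forall>\<^sub>F k in sequentially. \<forall>y\<in>cball z r. dist (R (k + J0) y) (\<Psi> y) < \<epsilon>"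
            unfolding eventually_sequentially by blast
        qed
        then show "\<exists>d>0. cball z d \<subseteq> ball 0 x \<and> uniform_limit (cball z d) (\<lambda>k. R (k + J0)) \<Psi> sequentially"
          using r by blast
      qed auto
    qed
    then have "\<Psi> field_differentiable at z" for z
      using holomorphic_on_imp_differentiable_at[of \<Psi> "ball 0 (cmod z + 1)" z] by auto
    then show ?thesis by (simp add: holomorphic_on_def)
  qed
  have approx: "cmod (\<Psi> z - 1 / z) \<le> e" if z: "Re z \<le> - \<delta> \<or> \<delta> \<le> \<bar>Im z\<bar>" for z
  proof -
    have "z \<in> W 0" unfolding W_def
    proof (intro CollectI allI impI)
      fix j
      have "\<bar>Re z - s (Suc j)\<bar> \<le> dist z (complex_of_real (s (Suc j)))"
          "\<bar>Im z\<bar> \<le> dist z (complex_of_real (s (Suc j)))"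
        using abs_Re_le_cmod[of "z - complex_of_real (s (Suc j))"] abs_Im_le_cmod[of "z - complex_of_real (s (Suc j))"]
        by (auto simp: dist_norm)
      then show "2 * d j \<le> dist z (complex_of_real (s (Suc j)))"
        using z d(2)[of j] s_nn[of "Suc j"] by linarith
    qed
    then show ?thesis using close[of z 0] by (simp add: R0 dist_norm norm_minus_commute)
  qed
  \<comment> \<open>\<open>\<Psi>\<close> differs by at most e from \<open>R J\<close>, a polynomial
    in 1/(z - s J), and this reciprocal is bounded because z keeps the distance min 1 \<eta> from
    the pole.\<close>
  have bdd: "\<exists>B. \<forall>z. Re z \<le> x \<or> \<eta> \<le> \<bar>Im z\<bar> \<longrightarrow> cmod (\<Psi> z) \<le> B" if \<eta>: "\<eta> > 0" for x \<eta>
  proof -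
    obtain J where J: "x + 1 \<le> s J" "\<And>z. Re z \<le> x \<or> \<eta> \<le> \<bar>Im z\<bar> \<Longrightarrow> z \<in> W J"
      using in_W[OF \<eta>, of x] by blast
    define c where "c = min 1 \<eta>"
    have c: "c > 0" using \<eta> by (simp add: c_def)
    have "compact (poly (Q J) ` cball 0 (1 / c))"
      by (intro compact_continuous_image continuous_intros) auto
    then obtain B where B: "\<And>u. u \<in> cball 0 (1 / c) \<Longrightarrow> cmod (poly (Q J) u) \<le> B"
      using compact_imp_bounded bounded_iff by (metis imageI)
    have "cmod (\<Psi> z) \<le> B + e" if z: "Re z \<le> x \<or> \<eta> \<le> \<bar>Im z\<bar>" for z
    proof -
      have "c \<le> cmod (z - complex_of_real (s J))"
        using z J(1) abs_Re_le_cmod[of "z - complex_of_real (s J)"] abs_Im_le_cmod[of "z - complex_of_real (s J)"]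
        by (auto simp: c_def)
      then have "cmod (1 / (z - complex_of_real (s J))) \<le> 1 / c"
        using c by (simp add: norm_divide frac_le)
      then have "cmod (R J z) \<le> B" unfolding R_def by (intro B) simp
      moreover have "dist (R J z) (\<Psi> z) \<le> e"
      proof -
        have "e * (1 / 2) ^ J \<le> e * 1" using e by (intro mult_left_mono power_le_one) auto
        then show ?thesis using close[OF J(2)[OF z]] by simp
      qed
      ultimately show ?thesis
        using norm_triangle_ineq4[of "R J z" "R J z - \<Psi> z"] by (simp add: dist_norm)
    qed
    then show ?thesis by blast
  qed
  show ?thesis using hol approx bdd by blast
qed

subsection \<open>Estimates for the weights\<close>

text \<open>Subadditivity of the power: t \<le> t^\<gamma> on [0, 1], applied to y/x and (x - y)/x,
  which add up to 1. The power of x - y is then at most 1 + (x - y). The resulting linear bound on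
  the variation of \<open>mu\<close> is what a Gaussian can absorb.\<close>

lemma powr_le_add_abs_diff:
  fixes x y \<gamma> :: real
  assumes "0 \<le> x" "0 \<le> y" "0 < \<gamma>" "\<gamma> \<le> 1"
  shows "x powr \<gamma> \<le> y powr \<gamma> + 1 + \<bar>x - y\<bar>"
proof (cases "x \<le> y")
  case True
  then have "x powr \<gamma> \<le> y powr \<gamma>" using assms by (intro powr_mono2) auto
  then show ?thesis by simp
next
  case False
  define t where "t = x - y"
  have t: "t > 0" "x = y + t" "x > 0" using False assms by (auto simp: t_def)
  have frac: "u / x \<le> (u / x) powr \<gamma>" if "0 \<le> u" "u \<le> x" for u
    using powr_mono'[of \<gamma> 1 "u / x"] that assms t by simp
  have "1 = y / x + t / x" using t by (simp flip: add_divide_distrib)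
  also have "\<dots> \<le> (y / x) powr \<gamma> + (t / x) powr \<gamma>" using t assms by (intro add_mono frac) auto
  also have "\<dots> = (y powr \<gamma> + t powr \<gamma>) / x powr \<gamma>" using t assms by (simp add: powr_divide add_divide_distrib)
  finally have 1: "x powr \<gamma> \<le> y powr \<gamma> + t powr \<gamma>" using t by (simp add: field_simps)
  have "t powr \<gamma> \<le> 1 + t"
  proof (cases "t \<le> 1")
    case True
    then show ?thesis using powr_le1[of \<gamma> t] t assms by simp
  next
    case False
    then show ?thesis using powr_mono[of \<gamma> 1 t] t assms by simp
  qed
  then show ?thesis using 1 t by simp
qed

lemma mu_le:
  assumes "0 < \<gamma>" "\<gamma> \<le> 1"
  shows "mu \<gamma> z \<le> mu \<gamma> w + 1 + \<bar>Re z - Re w\<bar>"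
  using powr_le_add_abs_diff[of "\<bar>Re z\<bar>" "\<bar>Re w\<bar>" \<gamma>] assms by (simp add: mu_def)

lemma sum_exp_neg_abs_int_bound:
  assumes \<rho>: "0 \<le> \<rho>" "\<rho> < (1::real)" and A: "finite (A :: int set)"
  shows "(\<Sum>i\<in>A. \<rho> ^ nat \<bar>i\<bar>) \<le> 2 / (1 - \<rho>)"
proof -
  define N where "N = Suc (Max (insert 0 ((\<lambda>i. nat \<bar>i\<bar>) ` A)))"
  have sub: "A \<subseteq> int ` {..<N} \<union> (\<lambda>k. - int k) ` {..<N}"
  proof
    fix i assume i: "i \<in> A"
    have "nat \<bar>i\<bar> < N" using i A by (auto simp: N_def less_Suc_eq_le intro!: Max_ge)
    moreover have "i = int (nat \<bar>i\<bar>) \<or> i = - int (nat \<bar>i\<bar>)" by auto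
    ultimately show "i \<in> int ` {..<N} \<union> (\<lambda>k. - int k) ` {..<N}" by blast
  qed
  have "(\<Sum>i\<in>A. \<rho> ^ nat \<bar>i\<bar>) \<le> (\<Sum>i\<in>int ` {..<N} \<union> (\<lambda>k. - int k) ` {..<N}. \<rho> ^ nat \<bar>i\<bar>)"
    using sub \<rho> by (intro sum_mono2) auto
  also have "\<dots> \<le> (\<Sum>i\<in>int ` {..<N}. \<rho> ^ nat \<bar>i\<bar>) + (\<Sum>i\<in>(\<lambda>k. - int k) ` {..<N}. \<rho> ^ nat \<bar>i\<bar>)"
    using \<rho> by (subst sum_Un) (auto intro!: sum_nonneg)
  also have "\<dots> = 2 * (\<Sum>k<N. \<rho> ^ k)" by (simp add: sum.reindex inj_on_def)
  also have "\<dots> \<le> 2 / (1 - \<rho>)" using \<rho> by (simp add: sum_gp_strict divide_right_mono)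
  finally show ?thesis .
qed

text \<open>Replacing x by the grid point to its left costs a factor exp \<delta> and leaves a
  two-sided geometric series. The bound depends neither on x nor on \<open>A\<close>, so summing
  over any number of columns costs a constant.\<close>

lemma sum_exp_neg_dist_grid_bound:
  fixes \<delta> :: real
  assumes \<delta>: "\<delta> > 0" and A: "finite (A :: int set)"
  shows "(\<Sum>j\<in>A. exp (- \<bar>x - of_int j * \<delta>\<bar>)) \<le> exp \<delta> * (2 / (1 - exp (- \<delta>)))"
proof -
  define j0 where "j0 = \<lfloor>x / \<delta>\<rfloor>"
  have j0: "of_int j0 * \<delta> \<le> x" "x \<le> (of_int j0 + 1) * \<delta>"
    using floor_divide_lower[OF \<delta>, of x] floor_divide_upper[OF \<delta>, of x]
    by (simp_all only: j0_def less_imp_le)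
  have "exp (- \<bar>x - of_int j * \<delta>\<bar>) \<le> exp \<delta> * exp (- \<delta>) ^ nat \<bar>j - j0\<bar>" for j
  proof -
    have "real_of_int \<bar>j - j0\<bar> * \<delta> = \<bar>of_int j * \<delta> - of_int j0 * \<delta>\<bar>"
      using \<delta> by (simp add: abs_mult flip: left_diff_distrib)
    also have "\<dots> \<le> \<bar>x - of_int j * \<delta>\<bar> + \<delta>" using j0 by (simp add: algebra_simps abs_if)
    finally have "- \<bar>x - of_int j * \<delta>\<bar> \<le> \<delta> + of_nat (nat \<bar>j - j0\<bar>) * (- \<delta>)" by simp
    then have "exp (- \<bar>x - of_int j * \<delta>\<bar>) \<le> exp (\<delta> + of_nat (nat \<bar>j - j0\<bar>) * (- \<delta>))" by simp
    also have "\<dots> = exp \<delta> * exp (- \<delta>) ^ nat \<bar>j - j0\<bar>" by (simp only: exp_add exp_of_nat_mult)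
    finally show ?thesis .
  qed
  then have "(\<Sum>j\<in>A. exp (- \<bar>x - of_int j * \<delta>\<bar>)) \<le> (\<Sum>j\<in>A. exp \<delta> * exp (- \<delta>) ^ nat \<bar>j - j0\<bar>)"
    by (rule sum_mono)
  also have "\<dots> = exp \<delta> * (\<Sum>i\<in>(\<lambda>j. j - j0) ` A. exp (- \<delta>) ^ nat \<bar>i\<bar>)"
    by (simp add: sum.reindex inj_on_def sum_distrib_left)
  also have "\<dots> \<le> exp \<delta> * (2 / (1 - exp (- \<delta>)))"
    using \<delta> A by (intro mult_left_mono sum_exp_neg_abs_int_bound) auto
  finally show "(\<Sum>j\<in>A. exp (- \<bar>x - of_int j * \<delta>\<bar>)) \<le> exp \<delta> * (2 / (1 - exp (- \<delta>)))" .
qed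

subsection \<open>The sets \<open>S_set\<close>\<close>

lemma closed_finite_part:
  assumes "closed K"
  shows "closed (finite_part K)"
proof -
  have "closed (ereal -` K)"
    using assms continuous_on_ereal[OF continuous_on_id] by (intro closed_vimage) auto
  then have "closed (Re -` (ereal -` K))" by (rule closed_vimage) (intro continuous_intros)
  moreover have "closed (Im -` {0})" by (rule closed_vimage) (auto intro: continuous_intros)
  ultimately have "closed (Re -` (ereal -` K) \<inter> Im -` {0})" by (rule closed_Int)
  moreover have "finite_part K = Re -` (ereal -` K) \<inter> Im -` {0}"
    by (auto simp: finite_part_def complex_eq_iff image_iff)
  ultimately show ?thesis by simp
qed

lemma in_U_nbhd_iff:
  "z \<in> U_nbhd K t \<longleftrightarrow> (\<exists>x. ereal x \<in> K \<and> cmod (z - of_real x) < 1 / t)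
     \<or> \<infinity> \<in> K \<and> t < Re z \<and> \<bar>Im z\<bar> < 1 / t \<or> - \<infinity> \<in> K \<and> Re z < - t \<and> \<bar>Im z\<bar> < 1 / t"
  by (auto simp: U_nbhd_def eucl_dist_def finite_part_def INF_less_iff dist_norm abs_less_iff)

lemma S_setD:
  assumes z: "z \<in> S_set K (real m)" and m: "2 \<le> m"
  shows "\<bar>Im z\<bar> < real m" and "ereal x \<in> K \<Longrightarrow> 1 / real m \<le> cmod (z - of_real x)"
    and "\<infinity> \<in> K \<Longrightarrow> Re z \<le> real m \<or> 1 / real m \<le> \<bar>Im z\<bar>"
    and "- \<infinity> \<in> K \<Longrightarrow> - real m \<le> Re z \<or> 1 / real m \<le> \<bar>Im z\<bar>"
proof -
  have "z \<notin> U_nbhd K (real m)" "\<bar>Im z\<bar> < real m"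
    using z m closure_subset[of "U_nbhd K (real m)"] by (auto simp: S_set_def Let_def)
  then show "\<bar>Im z\<bar> < real m" "ereal x \<in> K \<Longrightarrow> 1 / real m \<le> cmod (z - of_real x)"
    "\<infinity> \<in> K \<Longrightarrow> Re z \<le> real m \<or> 1 / real m \<le> \<bar>Im z\<bar>"
    "- \<infinity> \<in> K \<Longrightarrow> - real m \<le> Re z \<or> 1 / real m \<le> \<bar>Im z\<bar>"
    by (auto simp: in_U_nbhd_iff not_less)
qed

text \<open>Membership means staying away from a closure, so some room is needed: \<open>e\<close>
  exceeds 1/m and the half strips are given a margin of 1. A ball of radius min 1 (e - 1/m) around z
  is then disjoint from \<open>U_nbhd\<close>.\<close>

lemma S_setI:
  assumes m: "2 \<le> m" and e: "1 / real m < e"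
    and im: "\<bar>Im z\<bar> < real m" and fin: "\<And>x. ereal x \<in> K \<Longrightarrow> e \<le> cmod (z - of_real x)"
    and pinf: "\<infinity> \<in> K \<Longrightarrow> Re z \<le> real m - 1 \<or> e \<le> \<bar>Im z\<bar>"
    and minf: "- \<infinity> \<in> K \<Longrightarrow> - (real m - 1) \<le> Re z \<or> e \<le> \<bar>Im z\<bar>"
  shows "z \<in> S_set K (real m)"
proof -
  define e' where "e' = min 1 (e - 1 / real m)"
  have e': "e' > 0" using e by (simp add: e'_def)
  have "ball z e' \<subseteq> - U_nbhd K (real m)"
  proof (intro subsetI ComplI)
    fix v assume v: "v \<in> ball z e'" and "v \<in> U_nbhd K (real m)"
    have d: "cmod (z - v) < e'" "\<bar>Re z - Re v\<bar> < e'" "\<bar>Im z - Im v\<bar> < e'"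
      using v abs_Re_le_cmod[of "z - v"] abs_Im_le_cmod[of "z - v"] by (auto simp: dist_norm)
    from \<open>v \<in> U_nbhd K (real m)\<close>
    consider x where "ereal x \<in> K" "cmod (v - of_real x) < 1 / real m"
      | "\<infinity> \<in> K" "real m < Re v" "\<bar>Im v\<bar> < 1 / real m"
      | "- \<infinity> \<in> K" "Re v < - real m" "\<bar>Im v\<bar> < 1 / real m"
      by (auto simp: in_U_nbhd_iff)
    then show False
    proof cases
      case (1 x)
      then have "cmod (z - of_real x) < e"
        using d(1) norm_triangle_ineq[of "z - v" "v - of_real x"] by (simp add: e'_def)
      then show ?thesis using fin 1 by force
    next
      case 2
      then show ?thesis using pinf d by (auto simp: e'_def)
    next
      case 3
      then show ?thesis using minf d by (auto simp: e'_def)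
    qed
  qed
  then have "ball z e' \<subseteq> interior (- U_nbhd K (real m))" by (rule interior_maximal) simp
  then have "z \<in> interior (- U_nbhd K (real m))" using e' by (meson centre_in_ball subsetD)
  then have "z \<notin> closure (U_nbhd K (real m))" by (simp add: interior_complement)
  then show ?thesis using m im by (simp add: S_set_def Let_def)
qed

text \<open>The approximants are estimated only on sets \<open>S_set\<close> with large index;
  monotonicity of sets and weights yields the remaining indices.\<close>

lemma OV_bdd_above_of_large:
  assumes a: "strict_mono_on {1..} a" and m: "\<And>z. 0 \<le> m z" and q: "1 \<le> q"
    and bdd: "\<And>n. q \<le> n \<Longrightarrow> bdd_above ((\<lambda>z. cmod (F z) * exp_weights a m n z) ` S_set K (real n))"
    and n: "1 \<le> n"
  shows "bdd_above ((\<lambda>z. cmod (F z) * exp_weights a m n z) ` S_set K (real n))"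
proof -
  define k where "k = max n q"
  obtain B where B: "\<And>z. z \<in> S_set K (real k) \<Longrightarrow> cmod (F z) * exp_weights a m k z \<le> B"
    using bdd[of k] by (auto simp: k_def bdd_above_def)
  have "a n \<le> a k" using strict_mono_on_leD[OF a, of n k] n q by (auto simp: k_def)
  then have "cmod (F z) * exp_weights a m n z \<le> B" if "z \<in> S_set K (real n)" for z
  proof -
    have "cmod (F z) * exp_weights a m n z \<le> cmod (F z) * exp_weights a m k z"
      using m[of z] \<open>a n \<le> a k\<close> by (auto simp: exp_weights_def intro!: mult_left_mono mult_right_mono)
    also have "\<dots> \<le> B" using that S_set_mono[of n k K] n by (intro B) (auto simp: k_def)
    finally show ?thesis .
  qed
  then show ?thesis by (auto intro!: bdd_aboveI)
qed

subsection \<open>Peak functions\<close>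

locale strip_grid =
  fixes K :: "ereal set" and p :: nat
  assumes closed_K: "closed K" and p2: "2 \<le> p"
begin

text \<open>The scale at which poles separate: \<open>S_set K p\<close> is at least 8\<delta> away
  from every admissible pole, while the edges beside the real axis lie within 3\<delta> of
  one.\<close>

definition \<delta> :: real where "\<delta> = 1 / (8 * real p)"

text \<open>One unit above the strip |Im z| < p containing \<open>S_set K p\<close>; this unit gives
  the exponential peaks of the outer edges their factor exp (-1).\<close>

definition T :: real where "T = real p + 1"

text \<open>The admissible locations of poles: all of them have distance at least \<open>1 / p\<close> to \<open>S_set K p\<close>.\<close>

definition P :: "real set" where
  "P = {x. ereal x \<in> K} \<union> (if \<infinity> \<in> K then {real p + 1..} else {}) \<union>
       (if - \<infinity> \<in> K then {..- (real p + 1)} else {})"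

text \<open>The points through which integration paths may run. As \<open>P\<close> contains whole
  rays at the infinite points of K, low points far out in the half strips are excluded too, not only
  points close to K.\<close>

definition good :: "complex \<Rightarrow> bool" where
  "good w \<longleftrightarrow> \<bar>Im w\<bar> \<le> T \<and> (\<delta> \<le> \<bar>Im w\<bar> \<or> (\<forall>b\<in>P. \<delta> \<le> \<bar>Re w - b\<bar>))"

lemma \<delta>: "0 < \<delta>" "8 * \<delta> = 1 / real p" "\<delta> \<le> 1 / 16" "\<delta> = 1 / (8 * real p)"
  using p2 by (auto simp: \<delta>_def divide_simps)

lemma T: "3 \<le> T" "T = real p + 1" using p2 by (auto simp: T_def)

text \<open>This is the reason for the offset 1 in \<open>P\<close>: a point of
  \<open>S_set K p\<close> has |Im z| \<ge> 1/p or real part at most p in the direction of the ray,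
  and the ray starts at p + 1.\<close>

lemma dist_S_set_P:
  assumes "z \<in> S_set K (real p)" "b \<in> P"
  shows "8 * \<delta> \<le> cmod (z - of_real b)"
proof -
  note S = S_setD[OF assms(1) p2]
  have le1: "1 / real p \<le> 1" using p2 by simp
  have reim: "\<bar>Re z - b\<bar> \<le> cmod (z - of_real b)" "\<bar>Im z\<bar> \<le> cmod (z - of_real b)"
    using abs_Re_le_cmod[of "z - of_real b"] abs_Im_le_cmod[of "z - of_real b"] by auto
  consider "ereal b \<in> K" | "\<infinity> \<in> K" "real p + 1 \<le> b" | "- \<infinity> \<in> K" "b \<le> - (real p + 1)"
    using assms(2) by (auto simp: P_def split: if_splits)
  then have "1 / real p \<le> cmod (z - of_real b)"
  proof cases
    case 1
    then show ?thesis by (rule S(2))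
  next
    case 2
    then show ?thesis using S(3) reim le1 by linarith
  next
    case 3
    then show ?thesis using S(4) reim le1 by linarith
  qed
  then show ?thesis by (simp add: \<delta>(2))
qed

lemma good_dist_P:
  assumes "good w" "b \<in> P"
  shows "\<delta> \<le> cmod (w - of_real b)"
  using assms abs_Re_le_cmod[of "w - of_real b"] abs_Im_le_cmod[of "w - of_real b"]
  by (auto simp: good_def)

text \<open>The factor 32 originates here: points within \<delta>/2 = 1/(16 p) of a good point still
  have distance \<delta>/2 > 1/(32 p) from K. A low point beyond 32 p - 1 in a half strip would
  force Re w into the ray in \<open>P\<close>, which \<open>good\<close> forbids below height
  \<delta>.\<close>

lemma good_cball_subset_S_set:
  assumes w: "good w"
  shows "cball w (\<delta> / 2) \<subseteq> S_set K (real (32 * p))"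
proof
  fix v assume v: "v \<in> cball w (\<delta> / 2)"
  have d: "cmod (w - v) \<le> \<delta> / 2" "\<bar>Re w - Re v\<bar> \<le> \<delta> / 2" "\<bar>Im w - Im v\<bar> \<le> \<delta> / 2"
    using v abs_Re_le_cmod[of "w - v"] abs_Im_le_cmod[of "w - v"] by (auto simp: dist_norm)
  have p0: "real p \<ge> 2" using p2 by simp
  show "v \<in> S_set K (real (32 * p))"
  proof (rule S_setI)
    show "2 \<le> 32 * p" using p2 by simp
    show "1 / real (32 * p) < \<delta> / 2" using p2 by (simp add: \<delta>_def divide_simps)
    have "\<bar>Im w\<bar> \<le> T" "real (32 * p) = 32 * real p" using w by (auto simp: good_def)
    then show "\<bar>Im v\<bar> < real (32 * p)" using d(3) \<delta>(3) T(2) p0 by linarith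
    show "\<delta> / 2 \<le> cmod (v - of_real x)" if "ereal x \<in> K" for x
      using good_dist_P[OF w, of x] that d(1) norm_triangle_ineq[of "w - v" "v - of_real x"]
      by (simp add: P_def)
    show "Re v \<le> real (32 * p) - 1 \<or> \<delta> / 2 \<le> \<bar>Im v\<bar>" if inf: "\<infinity> \<in> K"
    proof (rule ccontr)
      assume "\<not> ?thesis"
      then have c: "\<not> Re v \<le> real (32 * p) - 1" "\<bar>Im v\<bar> < \<delta> / 2" "real (32 * p) = 32 * real p" by auto
      have "real p + 1 \<le> Re w" using c(1,3) d(2) \<delta>(3) p0 by linarith
      then have "Re w \<in> P" using inf by (simp add: P_def)
      moreover have "\<bar>Im w\<bar> < \<delta>" using c(2) d(3) by linarith
      ultimately have "Re w \<in> P" "\<bar>Im w\<bar> < \<delta>" by blast+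
      then show False using w \<delta> by (auto simp: good_def)
    qed
    show "- (real (32 * p) - 1) \<le> Re v \<or> \<delta> / 2 \<le> \<bar>Im v\<bar>" if inf: "- \<infinity> \<in> K"
    proof (rule ccontr)
      assume "\<not> ?thesis"
      then have c: "\<not> - (real (32 * p) - 1) \<le> Re v" "\<bar>Im v\<bar> < \<delta> / 2" "real (32 * p) = 32 * real p" by auto
      have "Re w \<le> - (real p + 1)" using c(1,3) d(2) \<delta>(3) p0 by linarith
      then have "Re w \<in> P" using inf by (simp add: P_def)
      moreover have "\<bar>Im w\<bar> < \<delta>" using c(2) d(3) by linarith
      ultimately have "Re w \<in> P" "\<bar>Im w\<bar> < \<delta>" by blast+
      then show False using w \<delta> by (auto simp: good_def)
    qed
  qed
qed

lemma S_set_subset_compl: "2 \<le> m \<Longrightarrow> S_set K (real m) \<subseteq> - finite_part K"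
  using S_setD(2) by (fastforce simp: finite_part_def)

lemma good_in_compl: "good w \<Longrightarrow> w \<in> - finite_part K"
  using good_cball_subset_S_set[of w] S_set_subset_compl[of "32 * p"] p2 \<delta> by force

text \<open>\<open>B\<close> is a parameter so that one sequence can serve all edges. The value 2/3
  fixes the base 3/2 with which \<open>N\<close> is chosen in the end.\<close>

definition peak :: "(nat \<Rightarrow> real) \<Rightarrow> complex set \<Rightarrow> (complex \<Rightarrow> complex) \<Rightarrow> bool" where
  "peak B E \<Phi> \<longleftrightarrow> \<Phi> holomorphic_on (- finite_part K) \<and> (\<forall>w\<in>E. 1 \<le> cmod (\<Phi> w)) \<and>
     (\<forall>z\<in>S_set K (real p). cmod (\<Phi> z) \<le> 2 / 3) \<and>
     (\<forall>m\<ge>2. \<forall>z\<in>S_set K (real m). cmod (\<Phi> z) \<le> B m)"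

definition near_pole :: "complex set \<Rightarrow> bool" where
  "near_pole E \<longleftrightarrow> (\<exists>b\<in>P. \<forall>w\<in>E. good w \<and> cmod (w - of_real b) \<le> 3 * \<delta>)"

text \<open>The exponential has modulus exp (\<sigma> Im z - T), where \<sigma> is the sign of
  \<tau>: exactly 1 on the edge, and at most exp (p - T) = exp (-1) on
  \<open>S_set K p\<close>.\<close>

lemma peak_horizontal:
  assumes \<tau>: "\<bar>\<tau>\<bar> = T" and E: "\<And>w. w \<in> E \<Longrightarrow> Im w = \<tau>"
  shows "\<exists>\<Phi>. peak (\<lambda>m. exp (real m)) E \<Phi>"
proof -
  define \<sigma> where "\<sigma> = sgn \<tau>"
  have st: "\<sigma> * \<tau> = T" "\<bar>\<sigma>\<bar> = 1" using \<tau> T by (auto simp: \<sigma>_def sgn_if split: if_splits)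
  have si: "\<sigma> * y \<le> \<bar>y\<bar>" for y using st(2) abs_mult[of \<sigma> y] abs_ge_self[of "\<sigma> * y"] by simp
  define \<Phi> where "\<Phi> z = exp (- \<i> * of_real \<sigma> * z - of_real T)" for z
  have N: "cmod (\<Phi> z) = exp (\<sigma> * Im z - T)" for z by (simp add: \<Phi>_def norm_exp_eq_Re)
  have "exp (-1) \<le> (2 / 3 :: real)"
    using exp_ge_add_one_self[of 1] by (simp add: exp_minus field_simps)
  moreover have "exp (\<sigma> * Im z - T) \<le> exp (-1)" if "z \<in> S_set K (real p)" for z
    using S_setD(1)[OF that p2] si[of "Im z"] T by simp
  ultimately have "cmod (\<Phi> z) \<le> 2 / 3" if "z \<in> S_set K (real p)" for z
    using that unfolding N by (meson order_trans)
  moreover have "cmod (\<Phi> z) \<le> exp (real m)" if "z \<in> S_set K (real m)" "2 \<le> m" for z m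
    using S_setD(1)[OF that] si[of "Im z"] T by (simp add: N)
  moreover have "\<Phi> holomorphic_on - finite_part K"
    unfolding \<Phi>_def by (intro holomorphic_intros)
  moreover have "1 \<le> cmod (\<Phi> w)" if "w \<in> E" for w using E[OF that] st by (simp add: N)
  ultimately show ?thesis unfolding peak_def by blast
qed

text \<open>As \<open>B\<close> must not depend on \<open>E\<close>, one entire
  \<open>\<Psi>\<close> is fixed for all poles on both rays, moved to b by translation and reflected
  for the infinite point on the left. A pole in K itself needs only 1/(z - b).\<close>

lemma exists_peak_near_pole: "\<exists>B. \<forall>E. near_pole E \<longrightarrow> (\<exists>\<Phi>. peak B E \<Phi>)"
proof -
  \<comment> \<open>With error 1/(24\<delta>), outside the half strip \<open>\<Psi>\<close> has
    modulus at least 1/(3\<delta>) - 1/(24\<delta>) = 7/(24\<delta>) within 3\<delta> of 0, and at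
    most 1/(8\<delta>) + 1/(24\<delta>) = 4/(24\<delta>) at distance 8\<delta> or more. Scaling by
    24\<delta>/7 turns these into 1 and 4/7 \<le> 2/3.\<close>
  obtain \<Psi> where \<Psi>: "\<Psi> holomorphic_on UNIV"
    "\<And>z. Re z \<le> - \<delta> \<or> \<delta> \<le> \<bar>Im z\<bar> \<Longrightarrow> cmod (\<Psi> z - 1 / z) \<le> 1 / (24 * \<delta>)"
    "\<forall>x. \<forall>\<eta>>0. \<exists>B. \<forall>z. Re z \<le> x \<or> \<eta> \<le> \<bar>Im z\<bar> \<longrightarrow> cmod (\<Psi> z) \<le> B"
    using entire_approx_inverse_off_half_strip[of \<delta> "1 / (24 * \<delta>)"] \<delta> by auto
  have "\<forall>m. \<exists>B. 2 \<le> m \<longrightarrow> (\<forall>z. Re z \<le> real m \<or> 1 / real m \<le> \<bar>Im z\<bar> \<longrightarrow> cmod (\<Psi> z) \<le> B)"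
    using \<Psi>(3) by (metis zero_less_divide_1_iff of_nat_0_less_iff less_le_trans zero_less_numeral)
  then obtain \<beta> where \<beta>: "\<And>m z. 2 \<le> m \<Longrightarrow> Re z \<le> real m \<or> 1 / real m \<le> \<bar>Im z\<bar> \<Longrightarrow> cmod (\<Psi> z) \<le> \<beta> m"
    by metis
  define B where "B m = max (3 * \<delta> * real m) ((24 * \<delta> / 7) * \<beta> m)" for m
  have lower: "7 / (24 * \<delta>) \<le> cmod (\<Psi> \<zeta>)"
    if "Re \<zeta> \<le> - \<delta> \<or> \<delta> \<le> \<bar>Im \<zeta>\<bar>" "cmod \<zeta> \<le> 3 * \<delta>" "\<zeta> \<noteq> 0" for \<zeta>
  proof -
    have "1 / (3 * \<delta>) \<le> cmod (1 / \<zeta>)" using that by (simp add: norm_divide frac_le)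
    moreover have "1 / (3 * \<delta>) - 1 / (24 * \<delta>) = 7 / (24 * \<delta>)" using \<delta> by (simp add: field_simps)
    ultimately show ?thesis
      using \<Psi>(2)[OF that(1)] norm_triangle_ineq2[of "1 / \<zeta>" "1 / \<zeta> - \<Psi> \<zeta>"] by (simp add: norm_minus_commute)
  qed
  have upper: "cmod (\<Psi> \<zeta>) \<le> 4 / (24 * \<delta>)"
    if "Re \<zeta> \<le> - \<delta> \<or> \<delta> \<le> \<bar>Im \<zeta>\<bar>" "8 * \<delta> \<le> cmod \<zeta>" for \<zeta>
  proof -
    have "cmod (1 / \<zeta>) \<le> 1 / (8 * \<delta>)"
      unfolding norm_divide norm_one using that(2) \<delta>(1) by (intro frac_le) auto
    moreover have "1 / (8 * \<delta>) + 1 / (24 * \<delta>) = 4 / (24 * \<delta>)" using \<delta> by (simp add: field_simps)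
    ultimately show ?thesis
      using \<Psi>(2)[OF that(1)] norm_triangle_ineq[of "1 / \<zeta>" "\<Psi> \<zeta> - 1 / \<zeta>"] by simp
  qed
  text \<open>Both half strips are treated at once: \<open>s\<close> is the sign of the infinite point.\<close>
  have ray: "\<exists>\<Phi>. peak B E \<Phi>"
    if s: "s = 1 \<or> s = (-1::real)" and b: "s * b \<ge> real p + 1" "b \<in> P"
      and E: "\<And>w. w \<in> E \<Longrightarrow> good w \<and> cmod (w - of_real b) \<le> 3 * \<delta>"
      and ray: "\<And>x. s * x \<ge> s * b \<Longrightarrow> x \<in> P"
      and S: "\<And>m z. 2 \<le> m \<Longrightarrow> z \<in> S_set K (real m) \<Longrightarrow> s * Re z \<le> real m \<or> 1 / real m \<le> \<bar>Im z\<bar>"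
    for s b E
  proof -
    define \<Phi> where "\<Phi> z = of_real (24 * \<delta> / 7) * \<Psi> (of_real s * (z - of_real b))" for z
    have "\<bar>24 * \<delta> / 7\<bar> = 24 * \<delta> / 7" using \<delta>(1) by simp
    then have "cmod (of_real (24 * \<delta> / 7)) = 24 * \<delta> / 7" by (simp only: norm_of_real)
    then have N: "cmod (\<Phi> z) = 24 * \<delta> / 7 * cmod (\<Psi> (of_real s * (z - of_real b)))" for z
      by (simp only: \<Phi>_def norm_mult)
    have abs_s: "\<bar>s * x\<bar> = \<bar>x\<bar>" "cmod (of_real s * z) = cmod z" for x z using s by (auto simp: norm_mult)
    have "\<Phi> holomorphic_on - finite_part K"
      unfolding \<Phi>_def
      by (intro holomorphic_intros holomorphic_on_compose_gen[OF _ \<Psi>(1), unfolded o_def]) auto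
    moreover have "1 \<le> cmod (\<Phi> w)" if w: "w \<in> E" for w
    proof -
      have gw: "good w" "cmod (w - of_real b) \<le> 3 * \<delta>" using E[OF w] by auto
      \<comment> \<open>The approximation by 1/z is available only off the half strip starting at b.
        A good point of height below \<delta> has real part outside \<open>P\<close>, hence not
        beyond b on the ray, and it is at least \<delta> short of b.\<close>
      have "s * (Re w - b) \<le> - \<delta> \<or> \<delta> \<le> \<bar>Im w\<bar>"
      proof (rule ccontr)
        assume neg: "\<not> ?thesis"
        then have far: "\<And>b'. b' \<in> P \<Longrightarrow> \<delta> \<le> \<bar>Re w - b'\<bar>" using gw by (auto simp: good_def)
        have "Re w \<notin> P" using far[of "Re w"] \<delta> by auto
        then have "\<not> s * b \<le> s * Re w" using ray by blast
        then have "\<bar>Re w - b\<bar> = - s * (Re w - b)" using s by (auto simp: algebra_simps)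
        then show False using neg far[OF b(2)] by simp
      qed
      moreover have "w \<noteq> of_real b" using good_dist_P[OF gw(1) b(2)] \<delta> by auto
      ultimately have "7 / (24 * \<delta>) \<le> cmod (\<Psi> (of_real s * (w - of_real b)))"
        using gw s by (intro lower) (auto simp: abs_s)
      then have "24 * \<delta> / 7 * (7 / (24 * \<delta>)) \<le> cmod (\<Phi> w)"
        unfolding N using \<delta> by (intro mult_left_mono) auto
      then show ?thesis using \<delta> by simp
    qed
    moreover have "cmod (\<Phi> z) \<le> 2 / 3" if z: "z \<in> S_set K (real p)" for z
    proof -
      have "\<delta> \<le> 1 / real p" using \<delta> by linarith
      then have "s * (Re z - b) \<le> - \<delta> \<or> \<delta> \<le> \<bar>Im z\<bar>"
        using S[OF p2 z] b(1) \<delta>(3) unfolding right_diff_distrib by linarith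
      then have "cmod (\<Psi> (of_real s * (z - of_real b))) \<le> 4 / (24 * \<delta>)"
        using dist_S_set_P[OF z b(2)] s by (intro upper) (auto simp: abs_s)
      then have "cmod (\<Phi> z) \<le> 24 * \<delta> / 7 * (4 / (24 * \<delta>))"
        unfolding N using \<delta> by (intro mult_left_mono) auto
      then show ?thesis using \<delta> by simp
    qed
    moreover have "cmod (\<Phi> z) \<le> B m" if z: "z \<in> S_set K (real m)" and m: "2 \<le> m" for z m
    proof -
      \<comment> \<open>Translating by a pole with s b \<ge> 0 only lowers s Re z, so the bound
        \<beta>_m of the untranslated function holds for every b on the ray.\<close>
      have "s * (Re z - b) \<le> real m \<or> 1 / real m \<le> \<bar>Im z\<bar>"
        using S[OF m z] b(1) p2 by (auto simp: algebra_simps)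
      then have "cmod (\<Psi> (of_real s * (z - of_real b))) \<le> \<beta> m"
        using s by (intro \<beta>[OF m]) (auto simp: abs_s)
      then have "cmod (\<Phi> z) \<le> 24 * \<delta> / 7 * \<beta> m"
        unfolding N using \<delta> by (intro mult_left_mono) auto
      then show ?thesis by (simp add: B_def)
    qed
    ultimately show ?thesis unfolding peak_def by blast
  qed
  have "\<exists>\<Phi>. peak B E \<Phi>" if np: "near_pole E" for E
  proof -
    obtain b where b: "b \<in> P" and E: "\<And>w. w \<in> E \<Longrightarrow> good w \<and> cmod (w - of_real b) \<le> 3 * \<delta>"
      using np unfolding near_pole_def by blast
    consider "ereal b \<in> K" | "\<infinity> \<in> K" "real p + 1 \<le> b" | "- \<infinity> \<in> K" "b \<le> - (real p + 1)"
      using b by (auto simp: P_def split: if_splits)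
    then show ?thesis
    proof cases
      case 1
      define \<Phi> where "\<Phi> z = of_real (3 * \<delta>) / (z - of_real b)" for z :: complex
      have N: "cmod (\<Phi> z) = 3 * \<delta> / cmod (z - of_real b)" for z
        using \<delta>(1) by (simp add: \<Phi>_def norm_divide norm_mult)
      have "\<Phi> holomorphic_on - finite_part K"
        unfolding \<Phi>_def using 1 by (intro holomorphic_intros) (auto simp: finite_part_def)
      moreover have "1 \<le> cmod (\<Phi> w)" if "w \<in> E" for w
      proof -
        have "cmod (w - of_real b) \<le> 3 * \<delta>" "0 < cmod (w - of_real b)"
          using E[OF that] good_dist_P[of w b] b \<delta>(1) by auto
        then show ?thesis unfolding N by (simp add: le_divide_eq_1_pos del: zero_less_norm_iff)
      qed
      moreover have "cmod (\<Phi> z) \<le> 2 / 3" if z: "z \<in> S_set K (real p)" for z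
      proof -
        have "3 * \<delta> / cmod (z - of_real b) \<le> 3 * \<delta> / (8 * \<delta>)"
          using dist_S_set_P[OF z b] \<delta> by (intro divide_left_mono mult_pos_pos) auto
        then show ?thesis using \<delta>(1) by (simp add: N)
      qed
      moreover have "cmod (\<Phi> z) \<le> B m" if z: "z \<in> S_set K (real m)" and m: "2 \<le> m" for z m
      proof -
        have "3 * \<delta> / cmod (z - of_real b) \<le> 3 * \<delta> / (1 / real m)"
          using S_setD(2)[OF z m 1] \<delta> m by (intro divide_left_mono mult_pos_pos) (auto intro: less_le_trans[of 0 "1 / real m"])
        then show ?thesis by (simp add: N B_def)
      qed
      ultimately show ?thesis unfolding peak_def by blast
    next
      case 2
      show ?thesis
      proof (rule ray[of 1 b])
        show "x \<in> P" if "1 * x \<ge> 1 * b" for x using that 2 by (auto simp: P_def)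
        show "1 * Re z \<le> real m \<or> 1 / real m \<le> \<bar>Im z\<bar>" if "2 \<le> m" "z \<in> S_set K (real m)" for m z
          using S_setD(3)[OF that(2,1) 2(1)] by simp
      qed (use 2 b E in auto)
    next
      case 3
      show ?thesis
      proof (rule ray[of "-1" b])
        show "x \<in> P" if "(-1) * x \<ge> (-1) * b" for x using that 3 by (auto simp: P_def)
        show "(-1) * Re z \<le> real m \<or> 1 / real m \<le> \<bar>Im z\<bar>" if "2 \<le> m" "z \<in> S_set K (real m)" for m z
          using S_setD(4)[OF that(2,1) 3(1)] by auto
      qed (use 3 b E in auto)
    qed
  qed
  then show ?thesis by blast
qed

lemma peak_mono: "peak B E \<Phi> \<Longrightarrow> (\<And>m. 2 \<le> m \<Longrightarrow> B m \<le> B' m) \<Longrightarrow> peak B' E \<Phi>"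
  unfolding peak_def by (meson order_trans)

lemma exists_peaks:
  obtains B where "\<And>E. near_pole E \<or> (\<exists>\<tau>. \<bar>\<tau>\<bar> = T \<and> (\<forall>w\<in>E. Im w = \<tau>)) \<Longrightarrow> \<exists>\<Phi>. peak B E \<Phi>"
proof -
  obtain B where B: "\<And>E. near_pole E \<Longrightarrow> \<exists>\<Phi>. peak B E \<Phi>" using exists_peak_near_pole by blast
  show ?thesis
  proof (rule that[of "\<lambda>m. max (B m) (exp (real m))"])
    fix E assume "near_pole E \<or> (\<exists>\<tau>. \<bar>\<tau>\<bar> = T \<and> (\<forall>w\<in>E. Im w = \<tau>))"
    then have "(\<exists>\<Phi>. peak B E \<Phi>) \<or> (\<exists>\<Phi>. peak (\<lambda>m. exp (real m)) E \<Phi>)"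
      using B peak_horizontal by blast
    moreover have "peak (\<lambda>m. max (B m) (exp (real m))) E \<Phi>"
      if "peak B E \<Phi> \<or> peak (\<lambda>m. exp (real m)) E \<Phi>" for \<Phi>
      using that by (elim disjE; elim peak_mono; simp)
    ultimately show "\<exists>\<Phi>. peak (\<lambda>m. max (B m) (exp (real m))) E \<Phi>" by blast
  qed
qed

end

subsection \<open>A Cauchy formula on a grid\<close>

lemma cmod_contour_integral_linepath_le:
  assumes "continuous_on (closed_segment a b) f" "0 \<le> B"
    and "\<And>w. w \<in> closed_segment a b \<Longrightarrow> cmod (f w) \<le> B"
  shows "cmod (contour_integral (linepath a b) f) \<le> B * cmod (b - a)"
  using has_contour_integral_bound_linepath[OF has_contour_integral_integral
      [OF contour_integrable_continuous_linepath[OF assms(1)]] assms(2,3)] .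

text \<open>Horizontal integrals run to the right and vertical ones upwards, so that shared sides of
  neighbouring rectangles cancel by subtraction. For z outside \<open>S\<close> the integrand is
  holomorphic on \<open>S\<close> and the sum is 0 by Cauchy's theorem.\<close>

lemma contour_integral_rectangle:
  fixes H :: "complex \<Rightarrow> complex"
  assumes S: "open S" "convex S" and H: "H holomorphic_on S"
    and xy: "x1 < x2" "y1 < y2" and sub: "cbox (Complex x1 y1) (Complex x2 y2) \<subseteq> S"
    and z: "z \<notin> path_image (rectpath (Complex x1 y1) (Complex x2 y2))"
  defines "I \<equiv> \<lambda>a b. contour_integral (linepath a b) (\<lambda>w. H w / (w - z))"
  shows "I (Complex x1 y1) (Complex x2 y1) + I (Complex x2 y1) (Complex x2 y2)
       - I (Complex x1 y2) (Complex x2 y2) - I (Complex x1 y1) (Complex x1 y2)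
       = (if z \<in> box (Complex x1 y1) (Complex x2 y2) then 2 * of_real pi * \<i> * H z else 0)"
proof -
  let ?a = "Complex x1 y1" and ?b = "Complex x2 y1" and ?c = "Complex x2 y2" and ?d = "Complex x1 y2"
  let ?g = "rectpath ?a ?c"
  have im_sub: "path_image ?g \<subseteq> S"
    using path_image_rectpath_subset_cbox[of ?a ?c] xy sub by auto
  have "((\<lambda>w. H w / (w - z)) has_contour_integral
      (if z \<in> box ?a ?c then 2 * of_real pi * \<i> * H z else 0)) ?g"
  proof (cases "z \<in> S")
    case True
    have "((\<lambda>w. H w / (w - z)) has_contour_integral (2 * pi * \<i> * winding_number ?g z * H z)) ?g"
      using True S H im_sub z by (intro Cauchy_integral_formula_convex_simple) (auto simp: interior_open)
    moreover have "winding_number ?g z = (if z \<in> box ?a ?c then 1 else 0)"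
    proof (cases "z \<in> box ?a ?c")
      case False
      then have "z \<notin> cbox ?a ?c"
        using z xy path_image_rectpath_cbox_minus_box[of ?a ?c] by auto
      then show ?thesis using winding_number_rectpath_outside[of ?a ?c z] xy False by simp
    qed (simp add: winding_number_rectpath)
    ultimately show ?thesis by (auto split: if_splits)
  next
    case False
    then have "z \<notin> box ?a ?c" using sub box_subset_cbox by blast
    moreover have "((\<lambda>w. H w / (w - z)) has_contour_integral 0) ?g"
      using False S H im_sub by (intro Cauchy_theorem_convex_simple[of _ S] holomorphic_intros) auto
    ultimately show ?thesis by simp
  qed
  then have eq: "contour_integral ?g (\<lambda>w. H w / (w - z)) =
      (if z \<in> box ?a ?c then 2 * of_real pi * \<i> * H z else 0)"
    by (rule contour_integral_unique)
  have segs: "path_image ?g = closed_segment ?a ?b \<union> closed_segment ?b ?c \<union> closed_segment ?c ?d \<union> closed_segment ?d ?a"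
    by (simp add: rectpath_def Let_def path_image_join Un_assoc)
  have cont: "continuous_on (path_image ?g) (\<lambda>w. H w / (w - z))"
    using z holomorphic_on_imp_continuous_on[OF H] im_sub
    by (intro continuous_intros) (auto intro: continuous_on_subset)
  have conts: "continuous_on (closed_segment u v) (\<lambda>w. H w / (w - z))"
    if "closed_segment u v \<subseteq> path_image ?g" for u v
    using continuous_on_subset[OF cont that] .
  have int: "(\<lambda>w. H w / (w - z)) contour_integrable_on linepath u v"
    if "closed_segment u v \<subseteq> path_image ?g" for u v
    using conts[OF that] by (rule contour_integrable_continuous_linepath)
  have "contour_integral ?g (\<lambda>w. H w / (w - z)) = I ?a ?b + (I ?b ?c + (I ?c ?d + I ?d ?a))"
  proof -
    have i: "(\<lambda>w. H w / (w - z)) contour_integrable_on linepath ?a ?b"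
      "(\<lambda>w. H w / (w - z)) contour_integrable_on linepath ?b ?c"
      "(\<lambda>w. H w / (w - z)) contour_integrable_on linepath ?c ?d"
      "(\<lambda>w. H w / (w - z)) contour_integrable_on linepath ?d ?a"
      using segs by (intro int; blast)+
    show ?thesis unfolding I_def rectpath_def Let_def using i by simp
  qed
  moreover have "I ?c ?d = - I ?d ?c"
    unfolding I_def by (rule contour_integral_reverse_linepath) (rule conts; use segs in blast)
  moreover have "I ?d ?a = - I ?a ?d"
    unfolding I_def by (rule contour_integral_reverse_linepath) (rule conts; use segs in blast)
  ultimately show ?thesis using eq by simp
qed

section \<open>Columns of the grid, their edges, and summation over columns\<close>

context strip_grid
begin

definition X :: "int \<Rightarrow> real" where "X j = of_int j * \<delta>"

text \<open>The window exceeds the column [X j, X j + \<delta>] by \<delta> on either side: the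
  middle rectangle then lies in an open vertical strip without points of K, and both vertical sides
  have distance at least \<delta> from \<open>P\<close>, hence consist of good points.\<close>

definition free :: "int \<Rightarrow> bool" where
  "free j \<longleftrightarrow> (\<forall>b\<in>P. \<not> (X j - \<delta> \<le> b \<and> b \<le> X j + 2 * \<delta>))"

definition fr :: "int \<Rightarrow> complex" where "fr j = (if free j then 1 else 0)"

text \<open>Boundary edges of the union of the rectangles of column \<open>j\<close>: the top and bottom edge, the two edges
  next to the real axis (present unless the column is free), and the short vertical edge that separates
  a free column from one that is not. The coefficient \<open>co j i\<close> is the orientation, \<open>0\<close> for an absent edge.\<close>

definition co :: "int \<Rightarrow> nat \<Rightarrow> complex" where
  "co j i = [- 1, 1, 1 - fr j, fr j - 1, fr (j - 1) - fr j] ! i"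

definition es :: "int \<Rightarrow> nat \<Rightarrow> complex" where
  "es j i = [Complex (X j) T, Complex (X j) (- T), Complex (X j) \<delta>, Complex (X j) (- \<delta>), Complex (X j) (- \<delta>)] ! i"

definition ee :: "int \<Rightarrow> nat \<Rightarrow> complex" where
  "ee j i = [Complex (X (j + 1)) T, Complex (X (j + 1)) (- T), Complex (X (j + 1)) \<delta>,
     Complex (X (j + 1)) (- \<delta>), Complex (X j) \<delta>] ! i"

definition edge :: "int \<Rightarrow> nat \<Rightarrow> complex set" where "edge j i = closed_segment (es j i) (ee j i)"

lemma X_simps: "X (j + 1) = X j + \<delta>" "X (j - 1) = X j - \<delta>"
  by (simp_all add: X_def algebra_simps)

lemma less_5_cases: "i < 5 \<Longrightarrow> i = 0 \<or> i = 1 \<or> i = 2 \<or> i = 3 \<or> i = (4::nat)"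
  by linarith

lemma sum_less_5: "(\<Sum>i<5. f i) = f 0 + f 1 + f 2 + f 3 + f (4::nat)" for f :: "nat \<Rightarrow> 'a::comm_monoid_add"
  by (simp add: eval_nat_numeral add.assoc)

lemma edge_simps:
  "w \<in> edge j 0 \<longleftrightarrow> Im w = T \<and> X j \<le> Re w \<and> Re w \<le> X j + \<delta>"
  "w \<in> edge j 1 \<longleftrightarrow> Im w = - T \<and> X j \<le> Re w \<and> Re w \<le> X j + \<delta>"
  "w \<in> edge j 2 \<longleftrightarrow> Im w = \<delta> \<and> X j \<le> Re w \<and> Re w \<le> X j + \<delta>"
  "w \<in> edge j 3 \<longleftrightarrow> Im w = - \<delta> \<and> X j \<le> Re w \<and> Re w \<le> X j + \<delta>"
  "w \<in> edge j 4 \<longleftrightarrow> Re w = X j \<and> \<bar>Im w\<bar> \<le> \<delta>"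
  using \<delta>(1)
  by (auto simp: edge_def es_def ee_def closed_segment_same_Im closed_segment_same_Re
      closed_segment_eq_real_ivl X_simps)

lemma edge_Re: "i < 5 \<Longrightarrow> w \<in> edge j i \<Longrightarrow> X j \<le> Re w \<and> Re w \<le> X j + \<delta>"
  using \<delta>(1) by (auto dest!: less_5_cases simp: edge_simps[unfolded One_nat_def])

lemma length_edge:
  assumes "i < 5"
  shows "cmod (ee j i - es j i) \<le> 1"
proof -
  have "ee j i - es j i = of_real \<delta> \<or> ee j i - es j i = \<i> * of_real (2 * \<delta>)"
    using less_5_cases[OF assms] by (auto simp: ee_def es_def X_simps complex_eq_iff)
  then have "cmod (ee j i - es j i) = \<bar>\<delta>\<bar> \<or> cmod (ee j i - es j i) = \<bar>2 * \<delta>\<bar>"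
    by (metis norm_of_real norm_mult norm_ii mult_1)
  then show ?thesis using \<delta>(1,3) by linarith
qed

lemma cmod_co_le: "i < 5 \<Longrightarrow> cmod (co j i) \<le> 1"
  by (auto dest!: less_5_cases simp: co_def fr_def)

lemma free_good:
  assumes "free (j - 1) \<or> free j" "Re w = X j" "\<bar>Im w\<bar> \<le> T"
  shows "good w"
proof -
  have "\<delta> \<le> \<bar>X j - b\<bar>" if "b \<in> P" for b
    using assms(1) that \<delta>(1) unfolding free_def X_simps by (smt (verit))
  then show ?thesis using assms by (auto simp: good_def)
qed

lemma edge_good:
  assumes "co j i \<noteq> 0" "i < 5" "w \<in> edge j i"
  shows "good w"
proof (cases "i = 4")
  case True
  then have "free (j - 1) \<or> free j" using assms(1) by (auto simp: co_def fr_def split: if_splits)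
  then show ?thesis using free_good[of j w] assms(3) True \<delta>(1,3) T(1) by (auto simp: edge_simps)
next
  case False
  then have "\<bar>Im w\<bar> \<le> T \<and> \<delta> \<le> \<bar>Im w\<bar>"
    using less_5_cases[OF assms(2)] assms(3) \<delta>(1,3) T(1) by (auto simp: edge_simps[unfolded One_nat_def])
  then show ?thesis by (simp add: good_def)
qed

text \<open>An inner edge is present only if its column, or one of the two columns it separates, is
  not free. The pole found there is within 2\<delta> of the edge horizontally, and the edge has
  height at most \<delta>; hence the 3\<delta> in \<open>near_pole\<close>.\<close>

lemma edge_near_pole:
  assumes "co j i \<noteq> 0" "i < 5"
  shows "near_pole (edge j i) \<or> (\<exists>\<tau>. \<bar>\<tau>\<bar> = T \<and> (\<forall>w\<in>edge j i. Im w = \<tau>))"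
proof -
  have near: "cmod (w - of_real b) \<le> 3 * \<delta>" if "\<bar>Re w - b\<bar> \<le> 2 * \<delta>" "\<bar>Im w\<bar> \<le> \<delta>" for w b
    using cmod_le[of "w - of_real b"] that by simp
  consider "i = 0" | "i = 1" | "i = 2 \<or> i = 3" | "i = 4" using less_5_cases[OF assms(2)] by blast
  then show ?thesis
  proof cases
    case 1
    then show ?thesis using T(1) by (intro disjI2 exI[of _ T]) (auto simp: edge_simps)
  next
    case 2
    then show ?thesis using T(1) by (intro disjI2 exI[of _ "- T"]) (auto simp: edge_simps[unfolded One_nat_def])
  next
    case 3
    then have "\<not> free j" using assms(1) by (auto simp: co_def fr_def split: if_splits)
    then obtain b where b: "b \<in> P" "X j - \<delta> \<le> b" "b \<le> X j + 2 * \<delta>" by (auto simp: free_def)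
    have "cmod (w - of_real b) \<le> 3 * \<delta>" if "w \<in> edge j i" for w
      using that 3 b \<delta>(1) by (intro near) (auto simp: edge_simps)
    then show ?thesis using b(1) edge_good[OF assms] unfolding near_pole_def by blast
  next
    case 4
    then have "\<not> free j \<or> \<not> free (j - 1)" using assms(1) by (auto simp: co_def fr_def split: if_splits)
    then obtain b where b: "b \<in> P" "X j - 2 * \<delta> \<le> b" "b \<le> X j + 2 * \<delta>"
      using \<delta>(1) unfolding free_def X_simps by (smt (verit))
    have "cmod (w - of_real b) \<le> 3 * \<delta>" if "w \<in> edge j i" for w
      using that 4 b \<delta>(1) by (intro near) (auto simp: edge_simps)
    then show ?thesis using b(1) edge_good[OF assms] unfolding near_pole_def by blast
  qed
qed

text \<open>The distance is at least 8\<delta> - 3\<delta> next to a pole and at least T - p = 1 on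
  the outer edges. So the Cauchy kernel costs at most 1/\<delta> for z in
  \<open>S_set K p\<close>.\<close>

lemma edge_dist_S_set:
  assumes "co j i \<noteq> 0" "i < 5" "w \<in> edge j i" "z \<in> S_set K (real p)"
  shows "\<delta> \<le> cmod (w - z)"
  using edge_near_pole[OF assms(1,2)]
proof
  assume "near_pole (edge j i)"
  then obtain b where b: "b \<in> P" "cmod (w - of_real b) \<le> 3 * \<delta>"
    using assms(3) unfolding near_pole_def by blast
  then show ?thesis
    using dist_S_set_P[OF assms(4) b(1)] norm_triangle_ineq[of "z - w" "w - of_real b"] \<delta>(1)
    by (simp add: norm_minus_commute)
next
  assume "\<exists>\<tau>. \<bar>\<tau>\<bar> = T \<and> (\<forall>w\<in>edge j i. Im w = \<tau>)"
  then have "\<bar>Im w\<bar> = T" using assms(3) by auto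
  then show ?thesis
    using S_setD(1)[OF assms(4) p2] abs_Im_le_cmod[of "w - z"] \<delta>(3) T(2) unfolding minus_complex.sel by linarith
qed

lemma sum_int_telescope: "(\<Sum>j\<in>{- int M..<int M}. f (j + 1) - f j) = f (int M) - f (- int M)"
  for f :: "int \<Rightarrow> complex"
proof (induction M)
  case (Suc M)
  have "{- int (Suc M)..<int (Suc M)} = insert (- int (Suc M)) (insert (int M) {- int M..<int M})" by auto
  then show ?case using Suc by (simp add: algebra_simps)
qed simp

text \<open>Cauchy's formula is added up for the upper, the lower and, in a free column, the middle
  rectangle. \<open>R j\<close> collects the vertical integrals over Re w = X j, its middle piece
  being counted for the column on the left. The mismatch with column j is the edge with coefficient
  \<open>fr (j - 1) - fr j\<close>; the rest telescopes.\<close>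

lemma column_integral:
  assumes H: "H holomorphic_on - finite_part K" and z: "z \<in> S_set K (real p)"
    and off: "\<And>j. Re z \<noteq> X j" "\<bar>Im z\<bar> \<noteq> \<delta>"
  defines "I \<equiv> \<lambda>a b. contour_integral (linepath a b) (\<lambda>w. H w / (w - z))"
  defines "R \<equiv> \<lambda>j. I (Complex (X j) \<delta>) (Complex (X j) T) + I (Complex (X j) (- T)) (Complex (X j) (- \<delta>))
      + fr (j - 1) * I (Complex (X j) (- \<delta>)) (Complex (X j) \<delta>)"
  shows "(\<Sum>i<5. co j i * I (es j i) (ee j i)) =
    (if j = \<lfloor>Re z / \<delta>\<rfloor> then 2 * of_real pi * \<i> * H z else 0) - (R (j + 1) - R j)"
proof -
  define c where "c = 2 * of_real pi * \<i> * H z"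
  have zT: "\<bar>Im z\<bar> < T" using S_setD(1)[OF z p2] T(2) by linarith
  have dT: "\<delta> < T" "0 < \<delta>" using \<delta>(1,3) T(1) by linarith+
  have XX: "X j < X (j + 1)" using \<delta>(1) by (simp add: X_simps)
  have col: "(X j < Re z \<and> Re z < X (j + 1)) \<longleftrightarrow> j = \<lfloor>Re z / \<delta>\<rfloor>"
  proof -
    have "j = \<lfloor>Re z / \<delta>\<rfloor> \<longleftrightarrow> of_int j \<le> Re z / \<delta> \<and> Re z / \<delta> < of_int j + 1" by (metis floor_eq_iff)
    also have "\<dots> \<longleftrightarrow> X j \<le> Re z \<and> Re z < X (j + 1)"
      using \<delta>(1) by (simp add: X_def field_simps)
    finally show ?thesis using off(1)[of j] by auto
  qed
  have notin: "z \<notin> path_image (rectpath (Complex (X j) y1) (Complex (X (j + 1)) y2))"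
    if "y1 < y2" "Im z \<noteq> y1" "Im z \<noteq> y2" for y1 y2
    using that XX off(1) by (subst path_image_rectpath) auto
  have inbox: "z \<in> box (Complex (X j) y1) (Complex (X (j + 1)) y2) \<longleftrightarrow> j = \<lfloor>Re z / \<delta>\<rfloor> \<and> y1 < Im z \<and> Im z < y2" for y1 y2
    using col by (auto simp: in_box_complex_iff)
  have U: "I (Complex (X j) \<delta>) (Complex (X (j + 1)) \<delta>) + I (Complex (X (j + 1)) \<delta>) (Complex (X (j + 1)) T)
       - I (Complex (X j) T) (Complex (X (j + 1)) T) - I (Complex (X j) \<delta>) (Complex (X j) T)
       = (if j = \<lfloor>Re z / \<delta>\<rfloor> \<and> \<delta> < Im z then c else 0)" (is "?lhs = _")
  proof -
    \<comment> \<open>K lies on the real axis, so the upper and lower rectangles sit in half planes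
      where H is holomorphic; only the middle one requires a free column.\<close>
    have "{w. 0 < Im w} \<subseteq> - finite_part K" by (auto simp: finite_part_def)
    then have "?lhs = (if z \<in> box (Complex (X j) \<delta>) (Complex (X (j + 1)) T) then c else 0)"
      unfolding I_def c_def
      by (intro contour_integral_rectangle[OF open_halfspace_Im_gt[of 0] convex_halfspace_Im_gt[of 0]
            holomorphic_on_subset[OF H] XX dT(1)] notin)
        (use dT off(2) zT in \<open>auto simp: in_cbox_complex_iff\<close>)
    then show ?thesis using zT by (simp add: inbox abs_less_iff)
  qed
  have L: "I (Complex (X j) (- T)) (Complex (X (j + 1)) (- T)) + I (Complex (X (j + 1)) (- T)) (Complex (X (j + 1)) (- \<delta>))
       - I (Complex (X j) (- \<delta>)) (Complex (X (j + 1)) (- \<delta>)) - I (Complex (X j) (- T)) (Complex (X j) (- \<delta>))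
       = (if j = \<lfloor>Re z / \<delta>\<rfloor> \<and> Im z < - \<delta> then c else 0)" (is "?lhs = _")
  proof -
    have "{w. Im w < 0} \<subseteq> - finite_part K" by (auto simp: finite_part_def)
    then have "?lhs = (if z \<in> box (Complex (X j) (- T)) (Complex (X (j + 1)) (- \<delta>)) then c else 0)"
      unfolding I_def c_def
      by (intro contour_integral_rectangle[OF open_halfspace_Im_lt[of 0] convex_halfspace_Im_lt[of 0]
            holomorphic_on_subset[OF H] XX] notin)
        (use dT off(2) zT in \<open>auto simp: in_cbox_complex_iff\<close>)
    then show ?thesis using zT by (simp add: inbox abs_less_iff)
  qed
  have Mid: "fr j * (I (Complex (X j) (- \<delta>)) (Complex (X (j + 1)) (- \<delta>)) + I (Complex (X (j + 1)) (- \<delta>)) (Complex (X (j + 1)) \<delta>)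
       - I (Complex (X j) \<delta>) (Complex (X (j + 1)) \<delta>) - I (Complex (X j) (- \<delta>)) (Complex (X j) \<delta>))
       = (if j = \<lfloor>Re z / \<delta>\<rfloor> \<and> \<bar>Im z\<bar> < \<delta> then c else 0)"
  proof (cases "free j")
    case True
    define S where "S = {w. X j - \<delta> < Re w} \<inter> {w. Re w < X j + 2 * \<delta>}"
    have "S \<inter> finite_part K = {}"
    proof -
      have "b \<notin> P" if "X j - \<delta> < b" "b < X j + 2 * \<delta>" for b
        using True that by (auto simp: free_def)
      then have "ereal b \<notin> K" if "X j - \<delta> < b" "b < X j + 2 * \<delta>" for b using that by (auto simp: P_def)
      then show ?thesis by (auto simp: S_def finite_part_def)
    qed
    then have "H holomorphic_on S" by (intro holomorphic_on_subset[OF H]) auto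
    moreover have "open S" "convex S"
      unfolding S_def by (intro open_Int convex_Int open_halfspace_Re_gt open_halfspace_Re_lt
          convex_halfspace_Re_gt convex_halfspace_Re_lt)+
    moreover have "cbox (Complex (X j) (- \<delta>)) (Complex (X (j + 1)) \<delta>) \<subseteq> S"
      using dT by (auto simp: S_def in_cbox_complex_iff X_simps)
    ultimately show ?thesis
      unfolding I_def using contour_integral_rectangle[of S H "X j" "X (j + 1)" "- \<delta>" \<delta> z] XX dT
        notin[of "- \<delta>" \<delta>] off(2) inbox[of "- \<delta>" \<delta>] True
      by (auto simp: fr_def c_def abs_less_iff)
  next
    case False
    then obtain b where b: "b \<in> P" "X j - \<delta> \<le> b" "b \<le> X j + 2 * \<delta>" by (auto simp: free_def)
    \<comment> \<open>An omitted middle rectangle contains no point of \<open>S_set K p\<close>: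
      such a point would lie within 3\<delta> of a pole instead of at least 8\<delta> away.\<close>
    have "\<not> (j = \<lfloor>Re z / \<delta>\<rfloor> \<and> \<bar>Im z\<bar> < \<delta>)"
    proof
      assume "j = \<lfloor>Re z / \<delta>\<rfloor> \<and> \<bar>Im z\<bar> < \<delta>"
      then have "\<bar>Re z - b\<bar> \<le> 2 * \<delta>" "\<bar>Im z\<bar> < \<delta>" using b col by (auto simp: X_simps)
      then show False
        using cmod_le[of "z - of_real b"] dist_S_set_P[OF z b(1)] dT by simp
    qed
    then show ?thesis using False by (auto simp: fr_def)
  qed
  have ind: "(if j = \<lfloor>Re z / \<delta>\<rfloor> \<and> \<delta> < Im z then c else 0) + (if j = \<lfloor>Re z / \<delta>\<rfloor> \<and> Im z < - \<delta> then c else 0)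
      + (if j = \<lfloor>Re z / \<delta>\<rfloor> \<and> \<bar>Im z\<bar> < \<delta> then c else 0) = (if j = \<lfloor>Re z / \<delta>\<rfloor> then c else 0)"
    using off(2) dT by (auto simp: abs_less_iff)
  have "(\<Sum>i<5. co j i * I (es j i) (ee j i)) =
      - I (Complex (X j) T) (Complex (X (j + 1)) T) + I (Complex (X j) (- T)) (Complex (X (j + 1)) (- T))
      + (1 - fr j) * I (Complex (X j) \<delta>) (Complex (X (j + 1)) \<delta>)
      + (fr j - 1) * I (Complex (X j) (- \<delta>)) (Complex (X (j + 1)) (- \<delta>))
      + (fr (j - 1) - fr j) * I (Complex (X j) (- \<delta>)) (Complex (X j) \<delta>)"
    unfolding sum_less_5 by (simp add: co_def es_def ee_def)
  also have "\<dots> = (if j = \<lfloor>Re z / \<delta>\<rfloor> then c else 0) - (R (j + 1) - R j)"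
    unfolding ind[symmetric] U[symmetric] L[symmetric] Mid[symmetric] R_def by (simp add: algebra_simps)
  finally show ?thesis unfolding c_def .
qed

text \<open>After telescoping only the vertical integrals over the two outermost grid lines survive,
  each of total length at most 2T. Their middle pieces occur only beside a free column, so that
  \<open>small\<close> applies on the whole path.\<close>

lemma grid_Cauchy_formula:
  assumes H: "H holomorphic_on - finite_part K" and z: "z \<in> S_set K (real p)"
    and off: "\<And>j. Re z \<noteq> X j" "\<bar>Im z\<bar> \<noteq> \<delta>"
    and M: "\<bar>Re z\<bar> < real M * \<delta>" and \<eta>: "0 \<le> \<eta>"
    and small: "\<And>w. good w \<Longrightarrow> \<bar>Re w\<bar> = real M * \<delta> \<Longrightarrow> cmod (H w / (w - z)) \<le> \<eta>"
  shows "cmod (2 * of_real pi * \<i> * H z -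
    (\<Sum>j\<in>{- int M..<int M}. \<Sum>i<5. co j i * contour_integral (linepath (es j i) (ee j i)) (\<lambda>w. H w / (w - z))))
    \<le> 4 * T * \<eta>"
proof -
  define I where "I a b = contour_integral (linepath a b) (\<lambda>w. H w / (w - z))" for a b
  define R where "R j = I (Complex (X j) \<delta>) (Complex (X j) T) + I (Complex (X j) (- T)) (Complex (X j) (- \<delta>))
      + fr (j - 1) * I (Complex (X j) (- \<delta>)) (Complex (X j) \<delta>)" for j
  define j0 where "j0 = \<lfloor>Re z / \<delta>\<rfloor>"
  have dT: "\<delta> < T" "0 < \<delta>" using \<delta>(1,3) T(1) by linarith+
  have j0: "j0 \<in> {- int M..<int M}"
  proof -
    have "- real M < Re z / \<delta>" "Re z / \<delta> < real M" using M dT by (auto simp: field_simps abs_less_iff)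
    then show ?thesis by (auto simp: j0_def le_floor_iff floor_less_iff)
  qed
  have "(\<Sum>j\<in>{- int M..<int M}. \<Sum>i<5. co j i * I (es j i) (ee j i)) =
      (\<Sum>j\<in>{- int M..<int M}. (if j = j0 then 2 * of_real pi * \<i> * H z else 0) - (R (j + 1) - R j))"
    unfolding I_def R_def j0_def by (intro sum.cong refl column_integral[OF H z off])
  also have "\<dots> = 2 * of_real pi * \<i> * H z - (R (int M) - R (- int M))"
    using j0 by (simp add: sum_subtractf[of "\<lambda>j. if j = j0 then _ else 0"] sum_int_telescope)
  finally have eq: "2 * of_real pi * \<i> * H z - (\<Sum>j\<in>{- int M..<int M}. \<Sum>i<5. co j i * I (es j i) (ee j i))
      = R (int M) - R (- int M)" by simp
  have bound: "cmod (R j) \<le> 2 * T * \<eta>" if j: "\<bar>X j\<bar> = real M * \<delta>" for j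
  proof -
    have ib: "cmod (I (Complex (X j) y1) (Complex (X j) y2)) \<le> \<eta> * (y2 - y1)"
      if y: "y1 \<le> y2" and g: "\<And>w. Re w = X j \<Longrightarrow> y1 \<le> Im w \<Longrightarrow> Im w \<le> y2 \<Longrightarrow> good w" for y1 y2
    proof -
      have seg: "Re w = X j \<and> y1 \<le> Im w \<and> Im w \<le> y2" if "w \<in> closed_segment (Complex (X j) y1) (Complex (X j) y2)" for w
        using that y by (auto simp: closed_segment_same_Re closed_segment_eq_real_ivl split: if_splits)
      have "cmod (I (Complex (X j) y1) (Complex (X j) y2)) \<le> \<eta> * cmod (Complex (X j) y2 - Complex (X j) y1)"
        unfolding I_def
      proof (rule cmod_contour_integral_linepath_le[OF _ \<eta>])
        have "closed_segment (Complex (X j) y1) (Complex (X j) y2) \<subseteq> - finite_part K"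
          using g seg good_in_compl by blast
        moreover have "w \<noteq> z" if "w \<in> closed_segment (Complex (X j) y1) (Complex (X j) y2)" for w
          using seg[OF that] off(1)[of j] by auto
        ultimately show "continuous_on (closed_segment (Complex (X j) y1) (Complex (X j) y2)) (\<lambda>w. H w / (w - z))"
          by (intro continuous_intros continuous_on_subset[OF holomorphic_on_imp_continuous_on[OF H]]) auto
        show "cmod (H w / (w - z)) \<le> \<eta>" if "w \<in> closed_segment (Complex (X j) y1) (Complex (X j) y2)" for w
          using seg[OF that] g j by (intro small) auto
      qed
      also have "cmod (Complex (X j) y2 - Complex (X j) y1) = y2 - y1" using y by (simp add: cmod_def)
      finally show ?thesis .
    qed
    have 1: "cmod (I (Complex (X j) \<delta>) (Complex (X j) T)) \<le> \<eta> * (T - \<delta>)"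
      using dT by (intro ib) (auto simp: good_def)
    have 2: "cmod (I (Complex (X j) (- T)) (Complex (X j) (- \<delta>))) \<le> \<eta> * (- \<delta> - (- T))"
      using dT by (intro ib) (auto simp: good_def)
    have 3: "cmod (fr (j - 1) * I (Complex (X j) (- \<delta>)) (Complex (X j) \<delta>)) \<le> \<eta> * (\<delta> - (- \<delta>))"
    proof (cases "free (j - 1)")
      case True
      have "cmod (I (Complex (X j) (- \<delta>)) (Complex (X j) \<delta>)) \<le> \<eta> * (\<delta> - (- \<delta>))"
        using dT True by (intro ib free_good) auto
      then show ?thesis using True by (simp add: fr_def)
    qed (use \<eta> dT in \<open>simp add: fr_def\<close>)
    have "cmod (R j) \<le> \<eta> * (T - \<delta>) + \<eta> * (- \<delta> - (- T)) + \<eta> * (\<delta> - (- \<delta>))"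
      unfolding R_def by (intro norm_triangle_le add_mono 1 2 3)
    then show ?thesis by (simp add: algebra_simps)
  qed
  have "cmod (R (int M)) \<le> 2 * T * \<eta>" "cmod (R (- int M)) \<le> 2 * T * \<eta>"
    using dT by (auto intro!: bound simp: X_def abs_mult)
  then show ?thesis
    using norm_triangle_ineq4[of "R (int M)" "R (- int M)"] unfolding eq[unfolded I_def] by simp
qed

end

subsection \<open>The approximants\<close>

lemma cmod_gaussian: "cmod (exp (- (d ^ 2))) = exp ((Im d)\<^sup>2 - (Re d)\<^sup>2)"
  by (simp add: norm_exp_eq_Re power2_eq_square)

lemma continuous_on_mu: "0 < \<gamma> \<Longrightarrow> continuous_on A (mu \<gamma>)"
  unfolding mu_def by (intro continuous_on_powr' continuous_intros) auto

lemma mu_nonneg: "0 \<le> mu \<gamma> z"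
  by (simp add: mu_def)

text \<open>|c| stems from the additive 1 in \<open>mu_le\<close>, t^2 from the growth of the
  Gaussian in the imaginary direction, and (|c| + 1)^2/4 is the maximum of (|c| + 1) E - E^2 over
  E.\<close>

definition wgt :: "real \<Rightarrow> real \<Rightarrow> real" where
  "wgt c t = exp (\<bar>c\<bar> + t\<^sup>2 + (\<bar>c\<bar> + 1)\<^sup>2 / 4)"

text \<open>Moving the weight from z to w costs exp (|c| E) with E = |Re z - Re w|. The Gaussian
  supplies exp (- E^2), which pays for this and still leaves exp (- E) for the summation over
  columns.\<close>

lemma gaussian_weight_bound:
  assumes \<gamma>: "0 < \<gamma>" "\<gamma> \<le> 1" and f: "cmod f \<le> exp (- (b * mu \<gamma> w))" and t: "\<bar>Im (w - z)\<bar> \<le> t"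
  shows "cmod f * cmod (exp (- ((w - z)\<^sup>2))) * exp (c * mu \<gamma> z)
    \<le> wgt c t * exp ((c - b) * mu \<gamma> w) * exp (- \<bar>Re z - Re w\<bar>)"
proof -
  define E where "E = \<bar>Re z - Re w\<bar>"
  have "\<bar>mu \<gamma> z - mu \<gamma> w\<bar> \<le> 1 + E"
    using mu_le[OF \<gamma>, of z w] mu_le[OF \<gamma>, of w z] by (simp add: E_def abs_le_iff)
  then have "\<bar>c\<bar> * \<bar>mu \<gamma> z - mu \<gamma> w\<bar> \<le> \<bar>c\<bar> * (1 + E)" by (intro mult_left_mono) auto
  then have "c * (mu \<gamma> z - mu \<gamma> w) \<le> \<bar>c\<bar> * (1 + E)"
    using abs_ge_self[of "c * (mu \<gamma> z - mu \<gamma> w)"] unfolding abs_mult by linarith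
  then have 1: "c * mu \<gamma> z \<le> c * mu \<gamma> w + \<bar>c\<bar> + \<bar>c\<bar> * E"
    unfolding right_diff_distrib distrib_left by linarith
  have 2: "(Im (w - z))\<^sup>2 \<le> t\<^sup>2" using t by (metis abs_ge_zero power2_abs power_mono)
  have 3: "(Re (w - z))\<^sup>2 = E\<^sup>2" by (simp add: E_def power2_commute)
  have 4: "\<bar>c\<bar> * E - E\<^sup>2 \<le> (\<bar>c\<bar> + 1)\<^sup>2 / 4 - E"
    using zero_le_power2[of "E - (\<bar>c\<bar> + 1) / 2"] by (simp add: power2_eq_square field_simps)
  have "cmod f * cmod (exp (- ((w - z)\<^sup>2))) * exp (c * mu \<gamma> z)
      \<le> exp (- (b * mu \<gamma> w)) * exp ((Im (w - z))\<^sup>2 - (Re (w - z))\<^sup>2) * exp (c * mu \<gamma> z)"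
    using f unfolding cmod_gaussian by (intro mult_right_mono) auto
  also have "\<dots> = exp (- (b * mu \<gamma> w) + (Im (w - z))\<^sup>2 - E\<^sup>2 + c * mu \<gamma> z)"
    by (simp only: 3 flip: exp_add) (simp add: algebra_simps)
  also have "\<dots> \<le> exp (\<bar>c\<bar> + t\<^sup>2 + (\<bar>c\<bar> + 1)\<^sup>2 / 4 + (c - b) * mu \<gamma> w + - E)"
    using 1 2 4 by (simp add: left_diff_distrib)
  also have "\<dots> = wgt c t * exp ((c - b) * mu \<gamma> w) * exp (- E)"
    by (simp only: wgt_def exp_add)
  finally show ?thesis by (simp add: E_def)
qed

lemma open_S_set: "open (S_set K t)"
proof -
  have "open {z::complex. \<bar>Im z\<bar> < s}" for s by (intro open_Collect_less continuous_intros)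
  then show ?thesis unfolding S_set_def Let_def by (intro open_Int) auto
qed

context strip_grid
begin

text \<open>A diagonal shift by t moves both coordinates, and only countably many t hit a grid line.
  The lemma serves to extend estimates to points on the grid by continuity.\<close>

lemma exists_off_grid_point:
  assumes U: "open U" "z \<in> U"
  shows "\<exists>z'\<in>U. (\<forall>j. Re z' \<noteq> X j) \<and> \<bar>Im z'\<bar> \<noteq> \<delta>"
proof -
  obtain e where e: "e > 0" "ball z e \<subseteq> U" using U openE by blast
  define bad where "bad = range (\<lambda>j. X j - Re z) \<union> {\<delta> - Im z, - \<delta> - Im z}"
  have "countable bad" by (simp add: bad_def)
  moreover have "uncountable {0<..<e / 2}" using e by (simp add: uncountable_open_interval)
  ultimately obtain t where t: "0 < t" "t < e / 2" "t \<notin> bad"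
    by (metis countable_subset greaterThanLessThan_iff subsetI)
  define z' where "z' = Complex (Re z + t) (Im z + t)"
  show ?thesis
  proof (intro bexI[of _ z'] conjI allI)
    have "cmod (z - z') \<le> \<bar>t\<bar> + \<bar>t\<bar>" using cmod_le[of "z - z'"] by (simp add: z'_def)
    then show "z' \<in> U" using t e by (auto simp: dist_norm)
    show "Re z' \<noteq> X j" for j
    proof
      assume "Re z' = X j"
      then have "t = X j - Re z" by (simp add: z'_def)
      then show False using t(3) unfolding bad_def by blast
    qed
    show "\<bar>Im z'\<bar> \<noteq> \<delta>" using t(3) \<delta>(1) by (auto simp: z'_def bad_def abs_if split: if_splits)
  qed
qed

end

text \<open>One approximation step: \<open>b\<close> stands for the weight exponent a_q,
  \<open>J\<close> for the kept columns, \<open>N\<close> for the power of the peaks. With these as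
  parameters, the constants in the estimates below do not involve \<open>F\<close>.\<close>

locale grid_approx = strip_grid +
  fixes B :: "nat \<Rightarrow> real" and \<Phi> :: "int \<Rightarrow> nat \<Rightarrow> complex \<Rightarrow> complex" and F :: "complex \<Rightarrow> complex"
    and \<gamma> b :: real and N :: nat and J :: "int set"
  assumes \<gamma>: "0 < \<gamma>" "\<gamma> \<le> 1"
    and \<Phi>: "\<And>j i. i < 5 \<Longrightarrow> co j i \<noteq> 0 \<Longrightarrow> peak B (edge j i) (\<Phi> j i)"
    and J: "finite J"
    and F: "F holomorphic_on - finite_part K"
    and F_le: "\<And>w. w \<in> S_set K (real (32 * p)) \<Longrightarrow> cmod (F w) \<le> exp (- (b * mu \<gamma> w))"
begin

definition \<Theta> :: "int \<Rightarrow> nat \<Rightarrow> complex \<Rightarrow> complex" where "\<Theta> j i z = \<Phi> j i z ^ N"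

text \<open>For \<open>z \<noteq> w\<close> the kernel is \<open>F w * exp (- (w - z)\<^sup>2) * (1 - (\<Phi> z / \<Phi> w) ^ N) / (w - z)\<close>.\<close>

definition kern :: "int \<Rightarrow> nat \<Rightarrow> complex \<Rightarrow> complex \<Rightarrow> complex" where
  "kern j i z w = F w * exp (- ((w - z)\<^sup>2)) * (divided_difference (\<Theta> j i) z w / \<Theta> j i w)"

definition term_int :: "int \<Rightarrow> nat \<Rightarrow> complex \<Rightarrow> complex" where
  "term_int j i z = contour_integral (linepath (es j i) (ee j i)) (kern j i z)"

definition approx :: "complex \<Rightarrow> complex" where
  "approx z = (if z \<in> finite_part K then 0
     else (\<Sum>j\<in>J. \<Sum>i<5. co j i * term_int j i z) / (2 * of_real pi * \<i>))"

definition grid_sum_bound :: real where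
  "grid_sum_bound = exp \<delta> * (2 / (1 - exp (- \<delta>)))"

lemma open_compl: "open (- finite_part K)"
  using closed_finite_part[OF closed_K] by (simp add: open_Compl)

lemma \<Theta>:
  assumes "i < 5" "co j i \<noteq> 0"
  shows "\<Theta> j i holomorphic_on - finite_part K" "w \<in> edge j i \<Longrightarrow> 1 \<le> cmod (\<Theta> j i w)"
    "z \<in> S_set K (real p) \<Longrightarrow> cmod (\<Theta> j i z) \<le> (2 / 3) ^ N"
    "2 \<le> m \<Longrightarrow> z \<in> S_set K (real m) \<Longrightarrow> cmod (\<Theta> j i z) \<le> B m ^ N"
  using \<Phi>[OF assms] unfolding peak_def \<Theta>_def norm_power
  by (auto intro!: holomorphic_intros power_mono one_le_power)

lemma edge_sub:
  assumes "i < 5" "co j i \<noteq> 0"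
  shows "edge j i \<subseteq> - finite_part K"
  using edge_good[OF assms(2,1)] good_in_compl by blast

lemma continuous_kern:
  assumes ij: "i < 5" "co j i \<noteq> 0"
  shows "continuous_on ((- finite_part K) \<times> edge j i) (\<lambda>(z, w). kern j i z w)"
proof -
  let ?U = "- finite_part K"
  have sub: "edge j i \<subseteq> ?U" by (rule edge_sub[OF ij])
  have dd: "continuous_on (?U \<times> edge j i) (\<lambda>x. divided_difference (\<Theta> j i) (fst x) (snd x))"
    using continuous_on_subset[OF continuous_on_divided_difference[OF \<Theta>(1)[OF ij] open_compl], of "?U \<times> edge j i"] sub
    by (auto simp: case_prod_beta')
  have snd: "continuous_on (?U \<times> edge j i) (\<lambda>x. g (snd x))" if "g holomorphic_on ?U" for g :: "complex \<Rightarrow> complex"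
    using sub by (intro continuous_on_compose2[OF holomorphic_on_imp_continuous_on[OF that]] continuous_intros) auto
  have "\<Theta> j i w \<noteq> 0" if "w \<in> edge j i" for w using \<Theta>(2)[OF ij that] by auto
  then show ?thesis
    unfolding kern_def case_prod_beta'
    by (intro continuous_intros dd snd[OF F] snd[OF \<Theta>(1)[OF ij]]) auto
qed

lemma holomorphic_term_int:
  assumes ij: "i < 5" "co j i \<noteq> 0"
  shows "term_int j i holomorphic_on - finite_part K"
proof -
  have "(\<lambda>z. contour_integral (linepath (es j i) (ee j i)) (kern j i z)) holomorphic_on - finite_part K"
  proof (rule holomorphic_on_contour_integral_linepath)
    show "continuous_on ((- finite_part K) \<times> closed_segment (es j i) (ee j i)) (\<lambda>(z, w). kern j i z w)"
      using continuous_kern[OF ij] by (simp add: edge_def)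
    fix w assume "w \<in> closed_segment (es j i) (ee j i)"
    then have w: "w \<in> edge j i" by (simp add: edge_def)
    then have "(\<lambda>z. divided_difference (\<Theta> j i) z w) holomorphic_on - finite_part K"
      using edge_sub[OF ij] by (intro holomorphic_divided_difference[OF \<Theta>(1)[OF ij] open_compl]) auto
    moreover have "\<Theta> j i w \<noteq> 0" using \<Theta>(2)[OF ij w] by auto
    ultimately show "(\<lambda>z. kern j i z w) holomorphic_on - finite_part K"
      unfolding kern_def by (intro holomorphic_intros) auto
  qed (rule open_compl)
  moreover have "term_int j i = (\<lambda>z. contour_integral (linepath (es j i) (ee j i)) (kern j i z))"
    by (simp add: term_int_def fun_eq_iff)
  ultimately show ?thesis by simp
qed

lemma holomorphic_approx: "approx holomorphic_on - finite_part K"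
proof -
  have "(\<lambda>z. co j i * term_int j i z) holomorphic_on - finite_part K" if "i < 5" for j i
    using holomorphic_term_int[OF that, of j] by (cases "co j i = 0") (auto intro!: holomorphic_intros)
  then have "(\<lambda>z. \<Sum>j\<in>J. \<Sum>i<5. co j i * term_int j i z) holomorphic_on - finite_part K"
    by (intro holomorphic_on_sum) auto
  then have "(\<lambda>z. (\<Sum>j\<in>J. \<Sum>i<5. co j i * term_int j i z) / (2 * of_real pi * \<i>)) holomorphic_on - finite_part K"
    by (rule holomorphic_on_divide) (auto intro: holomorphic_intros)
  then show ?thesis
    by (rule holomorphic_transform) (simp add: approx_def)
qed

lemma exp_edge_dist:
  assumes "i < 5" "w \<in> edge j i"
  shows "exp (- \<bar>Re z - Re w\<bar>) \<le> exp \<delta> * exp (- \<bar>Re z - X j\<bar>)"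
proof -
  have "- \<bar>Re z - Re w\<bar> \<le> \<delta> + - \<bar>Re z - X j\<bar>" using edge_Re[OF assms] by linarith
  then show ?thesis by (simp flip: exp_add)
qed

lemma F_gaussian_bound:
  assumes ij: "i < 5" "co j i \<noteq> 0" and w: "w \<in> edge j i" and m: "2 \<le> m" and z: "z \<in> S_set K (real m)"
  shows "cmod (F w) * cmod (exp (- ((w - z)\<^sup>2)))
    \<le> wgt c (T + real m) * exp ((c - b) * mu \<gamma> w) * (exp \<delta> * exp (- \<bar>Re z - X j\<bar>)) * exp (- (c * mu \<gamma> z))"
proof -
  have good: "good w" using edge_good ij w by blast
  then have wS: "w \<in> S_set K (real (32 * p))" using good_cball_subset_S_set[of w] \<delta>(1) by auto
  have "\<bar>Im (w - z)\<bar> \<le> T + real m" using good S_setD(1)[OF z m] by (auto simp: good_def)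
  then have "cmod (F w) * cmod (exp (- ((w - z)\<^sup>2))) * exp (c * mu \<gamma> z)
    \<le> wgt c (T + real m) * exp ((c - b) * mu \<gamma> w) * exp (- \<bar>Re z - Re w\<bar>)"
    by (rule gaussian_weight_bound[OF \<gamma> F_le[OF wS]])
  also have "\<dots> \<le> wgt c (T + real m) * exp ((c - b) * mu \<gamma> w) * (exp \<delta> * exp (- \<bar>Re z - X j\<bar>))"
    using exp_edge_dist[OF ij(1) w] by (intro mult_left_mono) (auto simp: wgt_def)
  finally have le: "cmod (F w) * cmod (exp (- ((w - z)\<^sup>2))) * exp (c * mu \<gamma> z) \<le> \<dots>" .
  have "cmod (F w) * cmod (exp (- ((w - z)\<^sup>2))) =
      cmod (F w) * cmod (exp (- ((w - z)\<^sup>2))) * exp (c * mu \<gamma> z) * exp (- (c * mu \<gamma> z))"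
    by (simp add: mult.assoc flip: exp_add)
  also have "\<dots> \<le> wgt c (T + real m) * exp ((c - b) * mu \<gamma> w) * (exp \<delta> * exp (- \<bar>Re z - X j\<bar>)) * exp (- (c * mu \<gamma> z))"
    using le by (intro mult_right_mono) auto
  finally show ?thesis .
qed

lemma sum_sum_grid_le:
  fixes f :: "int \<Rightarrow> nat \<Rightarrow> complex"
  assumes A: "finite A" and C: "0 \<le> C"
    and f: "\<And>j i. j \<in> A \<Longrightarrow> i < 5 \<Longrightarrow> cmod (f j i) \<le> C * exp (- \<bar>x - X j\<bar>)"
  shows "cmod (\<Sum>j\<in>A. \<Sum>i<5. f j i) \<le> 5 * C * grid_sum_bound"
proof -
  have "cmod (\<Sum>j\<in>A. \<Sum>i<5. f j i) \<le> (\<Sum>j\<in>A. \<Sum>i<(5::nat). C * exp (- \<bar>x - X j\<bar>))"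
    using f by (intro order_trans[OF norm_sum] sum_mono) auto
  also have "\<dots> = 5 * C * (\<Sum>j\<in>A. exp (- \<bar>x - X j\<bar>))" by (simp add: sum_distrib_left mult.assoc)
  also have "\<dots> \<le> 5 * C * grid_sum_bound"
    unfolding grid_sum_bound_def X_def using C A \<delta>(1)
    by (intro mult_left_mono sum_exp_neg_dist_grid_bound) auto
  finally show ?thesis .
qed

lemma cmod_co_mult_integral_le:
  assumes ij: "i < 5" and f: "co j i \<noteq> 0 \<Longrightarrow> continuous_on (edge j i) f" and C: "0 \<le> C"
    and le: "\<And>w. co j i \<noteq> 0 \<Longrightarrow> w \<in> edge j i \<Longrightarrow> cmod (f w) \<le> C"
  shows "cmod (co j i * contour_integral (linepath (es j i) (ee j i)) f) \<le> C"
proof (cases "co j i = 0")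
  case False
  have "cmod (contour_integral (linepath (es j i) (ee j i)) f) \<le> C * cmod (ee j i - es j i)"
    using f le C False by (intro cmod_contour_integral_linepath_le) (auto simp: edge_def)
  also have "\<dots> \<le> C * 1" using length_edge[OF ij] C by (intro mult_left_mono) auto
  finally show ?thesis
    using cmod_co_le[OF ij, of j] mult_mono[of "cmod (co j i)" 1 _ "C * 1"] by (simp add: norm_mult)
qed (use C in simp)

lemma two_pi_ge_1: "1 \<le> cmod (2 * of_real pi * \<i>)"
  using pi_gt3 by (simp add: norm_mult)

text \<open>\<open>D\<close> controls the weight ratio on the kept columns and \<open>BN\<close> the
  powers of the peaks; both are made polynomial in r later. The condition
  \<open>32 * p \<le> m\<close> ensures that the discs of radius \<delta>/2 around edge points lie
  in \<open>S_set K m\<close>, where the peaks are bounded.\<close>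

lemma approx_bound:
  assumes m: "32 * p \<le> m" and z: "z \<in> S_set K (real m)"
    and D: "0 \<le> D" "\<And>j i w. j \<in> J \<Longrightarrow> i < 5 \<Longrightarrow> w \<in> edge j i \<Longrightarrow> exp ((c - b) * mu \<gamma> w) \<le> D"
    and BN: "B m ^ N \<le> BN" "0 \<le> BN"
  shows "cmod (approx z) * exp (c * mu \<gamma> z)
    \<le> 5 * (wgt c (T + real m) * D * exp \<delta> * ((1 + BN) * (2 / \<delta>))) * grid_sum_bound"
proof -
  have m2: "2 \<le> m" using m p2 by linarith
  define C where "C = wgt c (T + real m) * D * exp \<delta> * ((1 + BN) * (2 / \<delta>)) * exp (- (c * mu \<gamma> z))"
  have C0: "0 \<le> C" using D(1) BN(2) \<delta>(1) by (auto simp: C_def wgt_def intro!: mult_nonneg_nonneg)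
  have Sm: "S_set K (real (32 * p)) \<subseteq> S_set K (real m)"
    using m p2 by (intro S_set_mono) auto
  have zU: "z \<in> - finite_part K" using S_set_subset_compl[OF m2] z by blast
  have "cmod (\<Sum>j\<in>J. \<Sum>i<5. co j i * term_int j i z) \<le> 5 * C * grid_sum_bound"
  proof (rule sum_sum_grid_le[OF J C0])
    fix j i assume j: "j \<in> J" and i: "i < (5::nat)"
    show "cmod (co j i * term_int j i z) \<le> C * exp (- \<bar>Re z - X j\<bar>)"
      unfolding term_int_def
    proof (rule cmod_co_mult_integral_le[OF i])
      assume ne: "co j i \<noteq> 0"
      note ij = i ne
      show "continuous_on (edge j i) (kern j i z)"
      proof -
        have "continuous_on (edge j i) ((\<lambda>(z, w). kern j i z w) \<circ> Pair z)"
          using zU by (intro continuous_on_compose continuous_intros continuous_on_subset[OF continuous_kern[OF ij]]) auto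
        then show ?thesis by (simp add: o_def)
      qed
      fix w assume w: "w \<in> edge j i"
      have good: "good w" using edge_good ij w by blast
      have cb: "cball w (\<delta> / 2) \<subseteq> S_set K (real m)" using good_cball_subset_S_set[OF good] Sm by blast
      have \<theta>: "1 \<le> cmod (\<Theta> j i w)" by (rule \<Theta>(2)[OF ij w])
      \<comment> \<open>No upper bound for \<Theta> at w is needed: the term |\<Theta>(w)| cancels
        against the denominator, and the other one only shrinks because |\<Theta>(w)| \<ge>
        1.\<close>
      have "cmod (divided_difference (\<Theta> j i) z w) \<le> (cmod (\<Theta> j i w) + BN) / (\<delta> / 2)"
        using \<Theta>(4)[OF ij m2] BN(1) cb S_set_subset_compl[OF m2] \<delta>(1)
        by (intro cmod_divided_difference_le[OF \<Theta>(1)[OF ij] open_compl _ _ z]) (auto intro: order_trans)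
      then have "cmod (divided_difference (\<Theta> j i) z w / \<Theta> j i w) \<le> (cmod (\<Theta> j i w) + BN) / (\<delta> / 2) / cmod (\<Theta> j i w)"
        by (simp only: norm_divide) (intro divide_right_mono; simp)
      also have "\<dots> = (1 + BN / cmod (\<Theta> j i w)) * (2 / \<delta>)"
      proof -
        have "(t + BN) / (\<delta> / 2) / t = (1 + BN / t) * (2 / \<delta>)" if "0 < t" for t
          using that \<delta>(1) by (simp add: field_simps)
        then show ?thesis using \<theta> by (simp only: less_le_trans[OF zero_less_one])
      qed
      also have "\<dots> \<le> (1 + BN) * (2 / \<delta>)"
      proof -
        have "BN / cmod (\<Theta> j i w) \<le> BN / 1" using \<theta> BN(2) by (intro divide_left_mono) auto
        then show ?thesis using \<delta>(1) by (intro mult_right_mono) auto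
      qed
      finally have dd: "cmod (divided_difference (\<Theta> j i) z w / \<Theta> j i w) \<le> (1 + BN) * (2 / \<delta>)" .
      have "cmod (F w) * cmod (exp (- ((w - z)\<^sup>2)))
          \<le> wgt c (T + real m) * exp ((c - b) * mu \<gamma> w) * (exp \<delta> * exp (- \<bar>Re z - X j\<bar>)) * exp (- (c * mu \<gamma> z))"
        by (rule F_gaussian_bound[OF ij w m2 z])
      also have "\<dots> \<le> wgt c (T + real m) * D * (exp \<delta> * exp (- \<bar>Re z - X j\<bar>)) * exp (- (c * mu \<gamma> z))"
        using D(2)[OF j i w] by (intro mult_right_mono mult_left_mono) (auto simp: wgt_def)
      finally have fg: "cmod (F w) * cmod (exp (- ((w - z)\<^sup>2))) \<le> \<dots>" .
      have "cmod (kern j i z w) \<le> (wgt c (T + real m) * D * (exp \<delta> * exp (- \<bar>Re z - X j\<bar>)) * exp (- (c * mu \<gamma> z))) * ((1 + BN) * (2 / \<delta>))"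
        unfolding kern_def norm_mult
        by (rule mult_mono[OF fg dd]) (use D(1) in \<open>auto simp: wgt_def intro!: mult_nonneg_nonneg\<close>)
      then show "cmod (kern j i z w) \<le> C * exp (- \<bar>Re z - X j\<bar>)" by (simp add: C_def mult_ac)
    qed (use C0 in auto)
  qed
  moreover have "cmod (approx z) \<le> cmod (\<Sum>j\<in>J. \<Sum>i<5. co j i * term_int j i z)"
  proof -
    have "cmod (approx z) = cmod (\<Sum>j\<in>J. \<Sum>i<5. co j i * term_int j i z) / cmod (2 * of_real pi * \<i>)"
      using zU by (simp only: approx_def norm_divide Compl_iff if_False)
    also have "\<dots> \<le> cmod (\<Sum>j\<in>J. \<Sum>i<5. co j i * term_int j i z) / 1"
      using two_pi_ge_1 by (intro divide_left_mono) auto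
    finally show ?thesis by simp
  qed
  ultimately have "cmod (approx z) * exp (c * mu \<gamma> z) \<le> 5 * C * grid_sum_bound * exp (c * mu \<gamma> z)"
    by (intro mult_right_mono) auto
  also have "\<dots> = 5 * (wgt c (T + real m) * D * exp \<delta> * ((1 + BN) * (2 / \<delta>))) * grid_sum_bound
      * (exp (- (c * mu \<gamma> z)) * exp (c * mu \<gamma> z))" by (simp only: C_def mult_ac)
  finally show ?thesis by (simp flip: exp_add)
qed

text \<open>Three errors occur: the outermost vertical lines, made small by moving them far out; the
  columns outside \<open>J\<close>, small by the weight ratio; and on the columns in
  \<open>J\<close> the correction of the kernel, small by the power of the peak. Each is O(1/r)
  after multiplication by the weight at z.\<close>

lemma approx_error_off_grid:
  assumes z: "z \<in> S_set K (real p)" and off: "\<And>j. Re z \<noteq> X j" "\<bar>Im z\<bar> \<noteq> \<delta>"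
    and r: "r > 0" and N: "(2 / 3) ^ N \<le> 1 / r" and cb: "c \<le> b"
    and outer: "\<And>j i w. j \<notin> J \<Longrightarrow> i < 5 \<Longrightarrow> w \<in> edge j i \<Longrightarrow> exp ((c - b) * mu \<gamma> w) \<le> 1 / r"
  shows "cmod (F z - approx z) * exp (c * mu \<gamma> z)
    \<le> (4 * T + 5 * (wgt c (T + real p) * exp \<delta> / \<delta>) * grid_sum_bound) / r"
proof -
  define W where "W = wgt c (T + real p)"
  have W: "W > 0" by (simp add: W_def wgt_def)
  define H where "H w = F w * exp (- ((w - z)\<^sup>2))" for w
  have H: "H holomorphic_on - finite_part K" unfolding H_def by (intro holomorphic_intros F)
  have Hz: "H z = F z" by (simp add: H_def)
  have zU: "z \<in> - finite_part K" using S_set_subset_compl[OF p2] z by blast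
  have le1: "exp ((c - b) * mu \<gamma> w) \<le> 1" for w
    using cb mu_nonneg[of \<gamma> w] by (simp add: mult_nonpos_nonneg)
  \<comment> \<open>On the outermost lines exp (- |Re z - Re w|) must cancel W r, which requires the
    distance |ln (W r)|; the additional 1 gives |w - z| \<ge> 1. This \<open>M\<close> may depend on
    z and r, because it does not enter the final constant.\<close>
  obtain M1 :: nat where M1: "(\<bar>Re z\<bar> + 1 + \<bar>ln (W * r)\<bar>) / \<delta> < real M1" using reals_Archimedean2 by blast
  obtain M2 :: nat where M2: "\<And>j. j \<in> J \<Longrightarrow> \<bar>j\<bar> < int M2"
  proof -
    have "\<bar>j\<bar> < int (nat (Max (insert 0 (abs ` J)) + 1))" if "j \<in> J" for j
    proof -
      have "\<bar>j\<bar> \<le> Max (insert 0 (abs ` J))" using that J by (intro Max_ge) auto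
      then show ?thesis by linarith
    qed
    then show ?thesis using that by blast
  qed
  define M where "M = max M1 M2"
  have "(\<bar>Re z\<bar> + 1 + \<bar>ln (W * r)\<bar>) / \<delta> < real M" using M1 by (simp add: M_def)
  then have M: "\<bar>Re z\<bar> + 1 + \<bar>ln (W * r)\<bar> < real M * \<delta>" using \<delta>(1) by (simp add: pos_divide_less_eq)
  have JM: "J \<subseteq> {- int M..<int M}" using M2 by (fastforce simp: M_def)
  define \<eta> where "\<eta> = exp (- (c * mu \<gamma> z)) / r"
  have \<eta>: "\<eta> > 0" using r by (simp add: \<eta>_def)
  let ?I = "\<lambda>j i. contour_integral (linepath (es j i) (ee j i)) (\<lambda>w. H w / (w - z))"
  let ?M = "{- int M..<int M}"
  have rem: "cmod (2 * of_real pi * \<i> * H z - (\<Sum>j\<in>?M. \<Sum>i<5. co j i * ?I j i)) \<le> 4 * T * \<eta>"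
  proof (rule grid_Cauchy_formula[OF H z off])
    show "\<bar>Re z\<bar> < real M * \<delta>" using M by linarith
    show "0 \<le> \<eta>" using \<eta> by simp
    fix w assume w: "good w" "\<bar>Re w\<bar> = real M * \<delta>"
    have "w \<in> S_set K (real (32 * p))" using good_cball_subset_S_set[OF w(1)] \<delta>(1) by auto
    then have Fw: "cmod (F w) \<le> exp (- (b * mu \<gamma> w))" by (rule F_le)
    have "\<bar>Im (w - z)\<bar> \<le> T + real p" using w(1) S_setD(1)[OF z p2] by (auto simp: good_def)
    then have "cmod (F w) * cmod (exp (- ((w - z)\<^sup>2))) * exp (c * mu \<gamma> z)
      \<le> W * exp ((c - b) * mu \<gamma> w) * exp (- \<bar>Re z - Re w\<bar>)"
      unfolding W_def by (rule gaussian_weight_bound[OF \<gamma> Fw])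
    also have "\<dots> \<le> W * 1 * exp (- ln (W * r))"
      using M w(2) le1[of w] W by (intro mult_mono) auto
    also have "\<dots> = 1 / r" using W r by (simp add: exp_minus field_simps)
    finally have "cmod (H w) * exp (c * mu \<gamma> z) \<le> 1 / r" by (simp add: H_def norm_mult)
    then have "cmod (H w) * exp (c * mu \<gamma> z) * exp (- (c * mu \<gamma> z)) \<le> 1 / r * exp (- (c * mu \<gamma> z))"
      by (intro mult_right_mono) auto
    then have Hw: "cmod (H w) \<le> \<eta>" by (simp add: \<eta>_def mult.assoc flip: exp_add)
    have "1 \<le> cmod (w - z)" using M w(2) abs_Re_le_cmod[of "w - z"] by auto
    then have "cmod (H w) / cmod (w - z) \<le> cmod (H w) / 1" by (intro divide_left_mono) auto
    then show "cmod (H w / (w - z)) \<le> \<eta>" using Hw by (simp add: norm_divide)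
  qed
  define C where "C = W * exp \<delta> / \<delta> * \<eta>"
  have C0: "0 \<le> C" using W \<delta>(1) \<eta> by (simp add: C_def)
  \<comment> \<open>The factor \<open>l\<close> allows one estimate for both kinds of columns: l =
    (2/3)^N on those in \<open>J\<close>, and l = 1 on the others, where the weight ratio alone is
    at most 1/r.\<close>
  have fg: "cmod (H w) * l / \<delta> \<le> C * exp (- \<bar>Re z - X j\<bar>)"
    if ij: "i < 5" "co j i \<noteq> 0" and w: "w \<in> edge j i" and l: "0 \<le> l" "exp ((c - b) * mu \<gamma> w) * l \<le> 1 / r" for j i w l
  proof -
    have "cmod (H w) * l \<le> W * exp ((c - b) * mu \<gamma> w) * (exp \<delta> * exp (- \<bar>Re z - X j\<bar>)) * exp (- (c * mu \<gamma> z)) * l"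
      unfolding H_def norm_mult W_def by (rule mult_right_mono[OF F_gaussian_bound[OF ij w p2 z] l(1)])
    also have "\<dots> = W * (exp \<delta> * exp (- \<bar>Re z - X j\<bar>)) * exp (- (c * mu \<gamma> z)) * (exp ((c - b) * mu \<gamma> w) * l)"
      by (simp only: mult_ac)
    also have "\<dots> \<le> W * (exp \<delta> * exp (- \<bar>Re z - X j\<bar>)) * exp (- (c * mu \<gamma> z)) * (1 / r)"
      using l W by (intro mult_left_mono) auto
    finally have "cmod (H w) * l / \<delta> \<le> W * (exp \<delta> * exp (- \<bar>Re z - X j\<bar>)) * exp (- (c * mu \<gamma> z)) * (1 / r) / \<delta>"
      using \<delta>(1) by (intro divide_right_mono) auto
    also have "\<dots> = C * exp (- \<bar>Re z - X j\<bar>)" using r \<delta>(1) by (simp add: C_def \<eta>_def field_simps)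
    finally show ?thesis .
  qed
  have contH: "continuous_on (edge j i) (\<lambda>w. H w / (w - z))" if ij: "i < 5" "co j i \<noteq> 0" for j i
  proof -
    have "w \<noteq> z" if "w \<in> edge j i" for w using edge_dist_S_set[OF ij(2,1) that z] \<delta>(1) by auto
    then show ?thesis
      by (intro continuous_intros continuous_on_subset[OF holomorphic_on_imp_continuous_on[OF H] edge_sub[OF ij]]) auto
  qed
  have contk: "continuous_on (edge j i) (kern j i z)" if ij: "i < 5" "co j i \<noteq> 0" for j i
  proof -
    have "continuous_on (edge j i) ((\<lambda>(z, w). kern j i z w) \<circ> Pair z)"
      using zU by (intro continuous_on_compose continuous_intros continuous_on_subset[OF continuous_kern[OF ij]]) auto
    then show ?thesis by (simp add: o_def)
  qed
  define d where "d j i = (if j \<in> J then co j i * (?I j i - term_int j i z) else co j i * ?I j i)" for j i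
  have d_le: "cmod (d j i) \<le> C * exp (- \<bar>Re z - X j\<bar>)" if i: "i < 5" for j i
  proof (cases "j \<in> J")
    case True
    have "co j i * (?I j i - term_int j i z) =
        co j i * contour_integral (linepath (es j i) (ee j i)) (\<lambda>w. H w / (w - z) - kern j i z w)"
    proof (cases "co j i = 0")
      case False
      then show ?thesis unfolding term_int_def
        using contH[OF i False] contk[OF i False]
        by (subst contour_integral_diff) (auto intro!: contour_integrable_continuous_linepath simp: edge_def)
    qed simp
    also have "cmod \<dots> \<le> C * exp (- \<bar>Re z - X j\<bar>)"
    proof (rule cmod_co_mult_integral_le[OF i])
      assume ne: "co j i \<noteq> 0"
      note ij = i ne
      show "continuous_on (edge j i) (\<lambda>w. H w / (w - z) - kern j i z w)"
        by (intro continuous_intros contH contk ij)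
      fix w assume w: "w \<in> edge j i"
      have dist: "\<delta> \<le> cmod (w - z)" using edge_dist_S_set[OF ne i w z] .
      have wz: "w \<noteq> z" using dist \<delta>(1) by auto
      have \<theta>: "1 \<le> cmod (\<Theta> j i w)" by (rule \<Theta>(2)[OF ij w])
      then have \<theta>0: "\<Theta> j i w \<noteq> 0" by auto
      \<comment> \<open>Off the diagonal the 1 in the modified kernel is the Cauchy kernel, so the
        difference is just the correction term.\<close>
      have "H w / (w - z) - kern j i z w = H w * (\<Theta> j i z / \<Theta> j i w) / (w - z)"
        using wz \<theta>0 by (simp add: kern_def H_def divided_difference_def divide_simps) (simp add: algebra_simps)
      then have "cmod (H w / (w - z) - kern j i z w) = cmod (H w) * (cmod (\<Theta> j i z) / cmod (\<Theta> j i w)) / cmod (w - z)"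
        by (simp add: norm_mult norm_divide)
      also have "\<dots> \<le> cmod (H w) * ((2 / 3) ^ N / 1) / \<delta>"
        using \<theta> \<Theta>(3)[OF ij z] dist \<delta>(1)
        by (intro frac_le mult_left_mono mult_nonneg_nonneg divide_nonneg_nonneg) auto
      also have "\<dots> \<le> C * exp (- \<bar>Re z - X j\<bar>)"
      proof (rule fg[OF ij w])
        have "exp ((c - b) * mu \<gamma> w) * ((2 / 3) ^ N / 1) \<le> 1 * (1 / r)"
          using le1[of w] N by (intro mult_mono) auto
        then show "exp ((c - b) * mu \<gamma> w) * ((2 / 3) ^ N / 1) \<le> 1 / r" by simp
      qed simp
      finally show "cmod (H w / (w - z) - kern j i z w) \<le> C * exp (- \<bar>Re z - X j\<bar>)" .
    qed (use C0 in simp)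
    finally show ?thesis using True by (simp add: d_def)
  next
    case False
    have "cmod (co j i * ?I j i) \<le> C * exp (- \<bar>Re z - X j\<bar>)"
    proof (rule cmod_co_mult_integral_le[OF i])
      assume ne: "co j i \<noteq> 0"
      note ij = i ne
      show "continuous_on (edge j i) (\<lambda>w. H w / (w - z))" by (rule contH[OF ij])
      fix w assume w: "w \<in> edge j i"
      have dist: "\<delta> \<le> cmod (w - z)" using edge_dist_S_set[OF ne i w z] .
      have "cmod (H w / (w - z)) \<le> cmod (H w) * 1 / \<delta>"
        using dist \<delta>(1) by (simp add: norm_divide frac_le)
      also have "\<dots> \<le> C * exp (- \<bar>Re z - X j\<bar>)"
        using outer[OF False i w] by (intro fg[OF ij w]) auto
      finally show "cmod (H w / (w - z)) \<le> C * exp (- \<bar>Re z - X j\<bar>)" .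
    qed (use C0 in simp)
    then show ?thesis using False by (simp add: d_def)
  qed
  have sum_d: "cmod (\<Sum>j\<in>?M. \<Sum>i<5. d j i) \<le> 5 * C * grid_sum_bound"
    by (rule sum_sum_grid_le[OF _ C0 d_le]) auto
  have split: "(\<Sum>j\<in>?M. \<Sum>i<5. d j i) = (\<Sum>j\<in>?M. \<Sum>i<5. co j i * ?I j i) - (\<Sum>j\<in>J. \<Sum>i<5. co j i * term_int j i z)"
  proof -
    have "(\<Sum>i<5. d j i) = (\<Sum>i<5. co j i * ?I j i) - (if j \<in> J then \<Sum>i<5. co j i * term_int j i z else 0)" for j
      by (simp add: d_def right_diff_distrib sum_subtractf)
    moreover have "(\<Sum>j\<in>?M. if j \<in> J then \<Sum>i<5. co j i * term_int j i z else 0) = (\<Sum>j\<in>J. \<Sum>i<5. co j i * term_int j i z)"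
      using JM by (simp add: Int_absorb1 flip: sum.inter_restrict)
    ultimately show ?thesis by (simp add: sum_subtractf)
  qed
  have "2 * of_real pi * \<i> * (F z - approx z) = 2 * of_real pi * \<i> * H z - (\<Sum>j\<in>J. \<Sum>i<5. co j i * term_int j i z)"
    using zU by (simp add: approx_def Hz field_simps)
  also have "\<dots> = (2 * of_real pi * \<i> * H z - (\<Sum>j\<in>?M. \<Sum>i<5. co j i * ?I j i)) + (\<Sum>j\<in>?M. \<Sum>i<5. d j i)"
    unfolding split by simp
  finally have "cmod (2 * of_real pi * \<i> * (F z - approx z)) \<le> 4 * T * \<eta> + 5 * C * grid_sum_bound"
    using norm_triangle_mono[OF rem sum_d] by simp
  moreover have "1 * cmod (F z - approx z) \<le> cmod (2 * of_real pi * \<i> * (F z - approx z))"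
    unfolding norm_mult[of "2 * of_real pi * \<i>"] using two_pi_ge_1 by (intro mult_right_mono) auto
  ultimately have "cmod (F z - approx z) * exp (c * mu \<gamma> z) \<le> (4 * T * \<eta> + 5 * C * grid_sum_bound) * exp (c * mu \<gamma> z)"
    by (intro mult_right_mono) auto
  also have "\<dots> = (4 * T + 5 * (W * exp \<delta> / \<delta>) * grid_sum_bound) * (\<eta> * exp (c * mu \<gamma> z))"
    by (simp add: C_def algebra_simps)
  also have "\<eta> * exp (c * mu \<gamma> z) = 1 / r" by (simp add: \<eta>_def flip: exp_add)
  finally show ?thesis by (simp add: W_def)
qed

text \<open>Both sides make sense on the grid lines too, and the left side is continuous: a
  violation would persist on an open set, which contains a point off the grid.\<close>

lemma approx_error:
  assumes z: "z \<in> S_set K (real p)"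
    and r: "r > 0" and N: "(2 / 3) ^ N \<le> 1 / r" and cb: "c \<le> b"
    and outer: "\<And>j i w. j \<notin> J \<Longrightarrow> i < 5 \<Longrightarrow> w \<in> edge j i \<Longrightarrow> exp ((c - b) * mu \<gamma> w) \<le> 1 / r"
  shows "cmod (F z - approx z) * exp (c * mu \<gamma> z)
    \<le> (4 * T + 5 * (wgt c (T + real p) * exp \<delta> / \<delta>) * grid_sum_bound) / r" (is "?f z \<le> ?C")
proof (rule ccontr)
  assume "\<not> ?f z \<le> ?C"
  then have gt: "?C < ?f z" by simp
  have cont: "continuous_on (S_set K (real p)) ?f"
  proof -
    have c: "continuous_on (S_set K (real p)) F" "continuous_on (S_set K (real p)) approx"
      using holomorphic_on_imp_continuous_on[OF F] holomorphic_on_imp_continuous_on[OF holomorphic_approx]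
        S_set_subset_compl[OF p2] by (blast intro: continuous_on_subset)+
    show ?thesis by (intro continuous_intros c continuous_on_mu[OF \<gamma>(1)])
  qed
  have "open (S_set K (real p) \<inter> ?f -` {?C<..})"
    using cont open_S_set by (intro continuous_open_preimage) auto
  moreover have "z \<in> S_set K (real p) \<inter> ?f -` {?C<..}" using z gt by simp
  ultimately have "\<exists>z'\<in>S_set K (real p) \<inter> ?f -` {?C<..}. (\<forall>j. Re z' \<noteq> X j) \<and> \<bar>Im z'\<bar> \<noteq> \<delta>"
    by (rule exists_off_grid_point)
  then obtain z' where z': "z' \<in> S_set K (real p) \<inter> ?f -` {?C<..}" "\<And>j. Re z' \<noteq> X j" "\<bar>Im z'\<bar> \<noteq> \<delta>"
    by blast
  have "?f z' \<le> ?C" using z' by (intro approx_error_off_grid[OF _ _ _ r N cb outer]) auto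
  then show False using z' by simp
qed

end

subsection \<open>Property \<open>(\<Omega>)\<close>\<close>

lemma finite_powr_grid:
  fixes \<delta> \<gamma> L :: real
  assumes "0 < \<delta>" "0 < \<gamma>"
  shows "finite {j::int. \<bar>of_int j * \<delta>\<bar> powr \<gamma> \<le> L}"
proof (rule finite_subset)
  define M where "M = \<lceil>max 0 L powr (1 / \<gamma>) / \<delta>\<rceil>"
  show "{j::int. \<bar>of_int j * \<delta>\<bar> powr \<gamma> \<le> L} \<subseteq> {- M..M}"
  proof
    fix j :: int assume "j \<in> {j. \<bar>of_int j * \<delta>\<bar> powr \<gamma> \<le> L}"
    then have "(\<bar>of_int j * \<delta>\<bar> powr \<gamma>) powr (1 / \<gamma>) \<le> max 0 L powr (1 / \<gamma>)"
      using assms by (intro powr_mono2) auto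
    then have "\<bar>of_int j * \<delta>\<bar> \<le> max 0 L powr (1 / \<gamma>)" using assms by (simp add: powr_powr)
    then have "of_int \<bar>j\<bar> \<le> max 0 L powr (1 / \<gamma>) / \<delta>"
      using assms by (simp add: abs_mult pos_le_divide_eq)
    then have "\<bar>j\<bar> \<le> M" unfolding M_def by linarith
    then show "j \<in> {- M..M}" by auto
  qed
qed simp

text \<open>The lower bound makes (2/3)^N at most 1/r, the upper bound keeps the N-th power of any
  fixed constant polynomial in r.\<close>

lemma exists_power_bracket:
  fixes r :: real
  assumes r: "1 \<le> r"
  obtains N where "r \<le> (3 / 2) ^ N" "(3 / 2) ^ N \<le> (3 / 2) * r"
proof -
  define N where "N = (LEAST N. r \<le> (3 / 2 :: real) ^ N)"
  obtain N0 where "r < (3 / 2 :: real) ^ N0" using real_arch_pow[of "3 / 2" r] by auto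
  then have "r \<le> (3 / 2 :: real) ^ N0" by simp
  then have N: "r \<le> (3 / 2) ^ N" unfolding N_def by (rule LeastI)
  have "(3 / 2) ^ N \<le> (3 / 2) * r"
  proof (cases N)
    case 0
    then show ?thesis using r by simp
  next
    case (Suc n)
    then have "\<not> r \<le> (3 / 2) ^ n" using not_less_Least[of n "\<lambda>N. r \<le> (3 / 2 :: real) ^ N"] by (simp add: N_def)
    then show ?thesis by (simp add: Suc)
  qed
  then show ?thesis using N that by blast
qed

section \<open>Seminorm estimates, linear operations, and the decomposition of F\<close>

lemma OV_seminorm_le:
  assumes "1 \<le> n" "\<And>z. z \<in> S_set K (real n) \<Longrightarrow> cmod (F z) * \<nu> n z \<le> C"
  shows "OV_seminorm K \<nu> n F \<le> C"
  unfolding OV_seminorm_def by (rule cSUP_least[OF S_set_nonempty[OF assms(1)] assms(2)])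

lemma OV_seminorm_upper:
  assumes "F \<in> OV_space K \<nu>" "1 \<le> n" "z \<in> S_set K (real n)"
  shows "cmod (F z) * \<nu> n z \<le> OV_seminorm K \<nu> n F"
  unfolding OV_seminorm_def using assms by (intro cSUP_upper) (auto simp: OV_space_def)

lemma OV_space_add_scale:
  assumes F: "F \<in> OV_space K (exp_weights a m)" and G: "G \<in> OV_space K (exp_weights a m)"
  shows "(\<lambda>z. of_real c * F z + of_real d * G z) \<in> OV_space K (exp_weights a m)"
proof -
  have "bdd_above ((\<lambda>z. cmod (of_real c * F z + of_real d * G z) * exp_weights a m n z) ` S_set K (real n))" if n: "1 \<le> n" for n
  proof (rule bdd_aboveI2)
    fix z assume z: "z \<in> S_set K (real n)"
    let ?\<nu> = "exp_weights a m" and ?s = "OV_seminorm K (exp_weights a m) n"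
    have "cmod (of_real c * F z + of_real d * G z) * ?\<nu> n z \<le> (\<bar>c\<bar> * cmod (F z) + \<bar>d\<bar> * cmod (G z)) * ?\<nu> n z"
      by (intro mult_right_mono norm_triangle_le) (auto simp: norm_mult exp_weights_def)
    also have "\<dots> = \<bar>c\<bar> * (cmod (F z) * ?\<nu> n z) + \<bar>d\<bar> * (cmod (G z) * ?\<nu> n z)" by (simp add: algebra_simps)
    also have "\<dots> \<le> \<bar>c\<bar> * ?s F + \<bar>d\<bar> * ?s G"
      by (intro add_mono mult_left_mono OV_seminorm_upper F G n z) auto
    finally show "cmod (of_real c * F z + of_real d * G z) * ?\<nu> n z \<le> \<bar>c\<bar> * ?s F + \<bar>d\<bar> * ?s G" .
  qed
  then show ?thesis using F G by (auto simp: OV_space_def intro!: holomorphic_intros)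
qed

lemma OV_space_scale:
  "F \<in> OV_space K (exp_weights a m) \<Longrightarrow> (\<lambda>z. of_real c * F z) \<in> OV_space K (exp_weights a m)"
  using OV_space_add_scale[of F K a m F c 0] by simp

lemma OV_seminorm_scale_le:
  assumes F: "F \<in> OV_space K (exp_weights a m)" and n: "1 \<le> n" and c: "0 \<le> c"
    and le: "c * OV_seminorm K (exp_weights a m) n F \<le> C"
  shows "OV_seminorm K (exp_weights a m) n (\<lambda>z. of_real c * F z) \<le> C"
proof (rule OV_seminorm_le[OF n])
  fix z assume z: "z \<in> S_set K (real n)"
  have "cmod (of_real c * F z) * exp_weights a m n z = c * (cmod (F z) * exp_weights a m n z)"
    using c by (simp add: norm_mult)
  also have "\<dots> \<le> c * OV_seminorm K (exp_weights a m) n F"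
    by (rule mult_left_mono[OF OV_seminorm_upper[OF F n z] c])
  finally show "cmod (of_real c * F z) * exp_weights a m n z \<le> C" using le by simp
qed

text \<open>The order of quantifiers matters: \<open>C0\<close> is independent of k and can later be
  removed by rescaling r, whereas n and C may depend on k. The same construction of f, with edges
  and peaks fixed in advance, serves every k.\<close>

lemma (in strip_grid) OV_decomposition:
  fixes a :: "nat \<Rightarrow> real" and \<gamma> :: real
  assumes a: "strict_mono_on {1..} a" and \<gamma>: "0 < \<gamma>" "\<gamma> \<le> 1"
  defines "\<nu> \<equiv> exp_weights a (mu \<gamma>)"
  shows "\<exists>C0>0. \<forall>k. \<exists>n C. C > 0 \<and> (\<forall>r\<ge>1. \<forall>F\<in>OV_space K \<nu>. OV_seminorm K \<nu> (32 * p) F \<le> 1 \<longrightarrow>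
      (\<exists>f\<in>OV_space K \<nu>. (1 \<le> k \<longrightarrow> OV_seminorm K \<nu> k f \<le> C * r ^ n) \<and>
         OV_seminorm K \<nu> p (\<lambda>z. F z - f z) \<le> C0 / r))"
proof -
  define q where "q = 32 * p"
  have q: "1 \<le> q" "p < q" "2 \<le> q" using p2 by (auto simp: q_def)
  define e where "e = a q - a p"
  have e: "e > 0" using strict_mono_onD[OF a, of p q] q p2 by (simp add: e_def)
  obtain B where B: "\<And>E. near_pole E \<or> (\<exists>\<tau>. \<bar>\<tau>\<bar> = T \<and> (\<forall>w\<in>E. Im w = \<tau>)) \<Longrightarrow> \<exists>\<Phi>. peak B E \<Phi>"
    using exists_peaks by blast
  have "\<forall>j i. \<exists>\<Phi>. i < 5 \<longrightarrow> co j i \<noteq> 0 \<longrightarrow> peak B (edge j i) \<Phi>"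
    using B edge_near_pole by meson
  then obtain \<Phi> where \<Phi>: "\<And>j i. i < 5 \<Longrightarrow> co j i \<noteq> 0 \<Longrightarrow> peak B (edge j i) (\<Phi> j i)" by metis
  define gsb where "gsb = exp \<delta> * (2 / (1 - exp (- \<delta>)))"
  have gsb: "gsb > 0" using \<delta>(1) by (simp add: gsb_def)
  define C0 where "C0 = 4 * T + 5 * (wgt (a p) (T + real p) * exp \<delta> / \<delta>) * gsb"
  have C0: "C0 > 0" using T(1) \<delta>(1) gsb by (simp add: C0_def wgt_def add_pos_pos)
  \<comment> \<open>On an edge of column j, \<open>mu\<close> deviates by at most 2 from its value
    at X j; this constant pays for that deviation.\<close>
  define c1 where "c1 = exp (2 * e)"
  define J where "J r = {j. exp (e * \<bar>X j\<bar> powr \<gamma>) \<le> c1 * r}" for r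
  have finJ: "finite (J r)" if r: "1 \<le> r" for r
  proof -
    have "J r \<subseteq> {j. \<bar>of_int j * \<delta>\<bar> powr \<gamma> \<le> ln (c1 * r) / e}"
    proof
      fix j assume "j \<in> J r"
      then have "ln (exp (e * \<bar>X j\<bar> powr \<gamma>)) \<le> ln (c1 * r)"
        using r by (subst ln_le_cancel_iff) (auto simp: J_def c1_def)
      then show "j \<in> {j. \<bar>of_int j * \<delta>\<bar> powr \<gamma> \<le> ln (c1 * r) / e}"
        using e by (simp add: X_def pos_le_divide_eq mult.commute)
    qed
    then show ?thesis using finite_powr_grid[OF \<delta>(1) \<gamma>(1)] finite_subset by blast
  qed
  have mu_edge: "\<bar>mu \<gamma> w - \<bar>X j\<bar> powr \<gamma>\<bar> \<le> 2" if "i < 5" "w \<in> edge j i" for j i w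
  proof -
    have "\<bar>Re w - X j\<bar> \<le> 1" using edge_Re[OF that] \<delta>(1,3) by linarith
    moreover have "mu \<gamma> w \<le> \<bar>X j\<bar> powr \<gamma> + 1 + \<bar>Re w - X j\<bar>"
      using mu_le[OF \<gamma>, of w "of_real (X j)"] by (simp add: mu_def)
    moreover have "\<bar>X j\<bar> powr \<gamma> \<le> mu \<gamma> w + 1 + \<bar>X j - Re w\<bar>"
      using mu_le[OF \<gamma>, of "of_real (X j)" w] by (simp add: mu_def)
    ultimately show ?thesis by linarith
  qed
  have inner: "exp (e * mu \<gamma> w) \<le> c1\<^sup>2 * r" if "j \<in> J r" "i < 5" "w \<in> edge j i" for j r i w
  proof -
    have "e * mu \<gamma> w \<le> e * (\<bar>X j\<bar> powr \<gamma> + 2)"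
      using mu_edge[OF that(2,3)] e by (intro mult_left_mono) auto
    then have "exp (e * mu \<gamma> w) \<le> exp (2 * e + e * \<bar>X j\<bar> powr \<gamma>)" by (simp add: algebra_simps)
    also have "\<dots> = c1 * exp (e * \<bar>X j\<bar> powr \<gamma>)" by (simp add: c1_def exp_add)
    also have "\<dots> \<le> c1 * (c1 * r)" using that(1) by (intro mult_left_mono) (auto simp: J_def c1_def)
    finally show ?thesis by (simp add: power2_eq_square)
  qed
  have outer: "exp ((a p - a q) * mu \<gamma> w) \<le> 1 / r"
    if "j \<notin> J r" "i < 5" "w \<in> edge j i" "1 \<le> r" for j r i w
  proof -
    have "e * (\<bar>X j\<bar> powr \<gamma>) \<le> e * (mu \<gamma> w + 2)"
      using mu_edge[OF that(2,3)] e by (intro mult_left_mono) auto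
    then have "exp (e * \<bar>X j\<bar> powr \<gamma>) \<le> exp (2 * e + e * mu \<gamma> w)" by (simp add: algebra_simps)
    also have "\<dots> = c1 * exp (e * mu \<gamma> w)" by (simp add: c1_def exp_add)
    finally have "c1 * r < c1 * exp (e * mu \<gamma> w)" using that(1) by (simp add: J_def)
    then have "r < exp (e * mu \<gamma> w)" by (simp add: c1_def)
    then have "inverse (exp (e * mu \<gamma> w)) \<le> inverse r" using that(4) by (intro le_imp_inverse_le) auto
    moreover have "(a p - a q) * mu \<gamma> w = - (e * mu \<gamma> w)" by (simp add: e_def algebra_simps)
    ultimately show ?thesis by (simp only: exp_minus inverse_eq_divide)
  qed
  have bound: "\<exists>n C. C > 0 \<and> (\<forall>r\<ge>1. \<forall>N. \<forall>F. (3 / 2) ^ N \<le> (3 / 2) * r \<longrightarrow>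
      grid_approx K p B \<Phi> F \<gamma> (a q) (J r) \<longrightarrow>
      (\<forall>z\<in>S_set K (real m). cmod (grid_approx.approx K p \<Phi> F N (J r) z) * exp (a m * mu \<gamma> z) \<le> C * r ^ n))"
    if m: "q \<le> m" for m
  proof -
    \<comment> \<open>B_m \<le> (3/2)^l gives B_m^N \<le> ((3/2)^N)^l \<le> (3r/2)^l. Likewise a_m -
      a_q \<le> s e bounds the weight ratio on the kept columns by the s-th power of exp (e mu)
      \<le> c1^2 r. So s + l is the exponent of r.\<close>
    obtain l where l: "max 1 (B m) \<le> (3 / 2) ^ l"
      using real_arch_pow[of "3 / 2" "max 1 (B m)"] by (auto intro: less_imp_le)
    obtain s :: nat where s: "(a m - a q) / e \<le> real s" using real_arch_simple by blast
    define C where "C = 5 * (wgt (a m) (T + real m) * (c1\<^sup>2) ^ s * exp \<delta> * ((2 * (3 / 2) ^ l) * (2 / \<delta>))) * gsb"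
    have C: "C > 0" using gsb \<delta>(1) by (simp add: C_def wgt_def c1_def)
    have "cmod (grid_approx.approx K p \<Phi> F N (J r) z) * exp (a m * mu \<gamma> z) \<le> C * r ^ (s + l)"
      if r: "1 \<le> r" and N: "(3 / 2) ^ N \<le> (3 / 2) * r" and ga: "grid_approx K p B \<Phi> F \<gamma> (a q) (J r)"
        and z: "z \<in> S_set K (real m)" for r N F z
    proof -
      interpret grid_approx K p B \<Phi> F \<gamma> "a q" N "J r" by (rule ga)
      \<comment> \<open>Nonnegativity is read off from an actual peak function; the top edge of
        column 0 is always present, with coefficient -1.\<close>
      have Bm: "0 \<le> B m"
      proof -
        have c00: "co 0 0 \<noteq> 0" by (simp add: co_def)
        have "cmod (\<Phi> 0 0 z) \<le> B m"
          using \<Phi>[of 0 0] c00 z m q(3) unfolding peak_def by auto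
        then show ?thesis using norm_ge_zero order_trans by blast
      qed
      have BN: "B m ^ N \<le> ((3 / 2) * r) ^ l"
      proof -
        have "B m ^ N \<le> ((3 / 2) ^ l) ^ N" using l Bm by (intro power_mono) auto
        also have "\<dots> = ((3 / 2) ^ N) ^ l" by (simp flip: power_mult add: mult.commute)
        also have "\<dots> \<le> ((3 / 2) * r) ^ l" using N by (intro power_mono) auto
        finally show ?thesis .
      qed
      have D: "exp ((a m - a q) * mu \<gamma> w) \<le> (c1\<^sup>2 * r) ^ s" if j: "j \<in> J r" "i < 5" "w \<in> edge j i" for j i w
      proof -
        have "a m - a q \<le> real s * e" using s e by (simp add: pos_divide_le_eq)
        then have "(a m - a q) * mu \<gamma> w \<le> real s * (e * mu \<gamma> w)"
          using mu_nonneg[of \<gamma> w] by (metis mult.assoc mult_right_mono)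
        then have "exp ((a m - a q) * mu \<gamma> w) \<le> exp (e * mu \<gamma> w) ^ s" by (simp flip: exp_of_nat_mult)
        also have "\<dots> \<le> (c1\<^sup>2 * r) ^ s" by (intro power_mono inner[OF j]) auto
        finally show ?thesis .
      qed
      have "cmod (approx z) * exp (a m * mu \<gamma> z)
          \<le> 5 * (wgt (a m) (T + real m) * (c1\<^sup>2 * r) ^ s * exp \<delta> * ((1 + ((3 / 2) * r) ^ l) * (2 / \<delta>))) * grid_sum_bound"
        using m r by (intro approx_bound z D BN) (auto simp: q_def)
      also have "\<dots> \<le> 5 * (wgt (a m) (T + real m) * (c1\<^sup>2 * r) ^ s * exp \<delta> * ((2 * ((3 / 2) * r) ^ l) * (2 / \<delta>))) * gsb"
      proof -
        have "1 \<le> ((3 / 2) * r) ^ l" using r by (intro one_le_power) auto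
        moreover have "grid_sum_bound = gsb" by (simp add: grid_sum_bound_def gsb_def)
        ultimately show ?thesis using r gsb \<delta>(1)
          by (simp only:) (intro mult_right_mono mult_left_mono; simp add: wgt_def)
      qed
      also have "\<dots> = C * r ^ (s + l)" by (simp only: C_def power_mult_distrib power_add mult_ac)
      finally show ?thesis .
    qed
    then show ?thesis using C by blast
  qed
  show ?thesis
  proof (intro exI[of _ C0] conjI allI C0)
    fix k
    \<comment> \<open>The estimates require an index of at least q; smaller k follow from
      monotonicity of the seminorms.\<close>
    define m where "m = max k q"
    have "q \<le> m" by (simp add: m_def)
    then obtain n C where C: "C > 0" and nC: "\<And>r N F z. 1 \<le> r \<Longrightarrow> (3 / 2) ^ N \<le> (3 / 2) * r \<Longrightarrow>
      grid_approx K p B \<Phi> F \<gamma> (a q) (J r) \<Longrightarrow> z \<in> S_set K (real m) \<Longrightarrow>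
      cmod (grid_approx.approx K p \<Phi> F N (J r) z) * exp (a m * mu \<gamma> z) \<le> C * r ^ n"
      using bound[of m] by blast
    have "\<exists>f\<in>OV_space K \<nu>. (1 \<le> k \<longrightarrow> OV_seminorm K \<nu> k f \<le> C * r ^ n) \<and>
         OV_seminorm K \<nu> p (\<lambda>z. F z - f z) \<le> C0 / r"
      if r: "1 \<le> r" and F: "F \<in> OV_space K \<nu>" and F1: "OV_seminorm K \<nu> (32 * p) F \<le> 1" for r F
    proof -
      obtain N where N: "r \<le> (3 / 2) ^ N" "(3 / 2) ^ N \<le> (3 / 2) * r" using exists_power_bracket[OF r] .
      have Fq: "cmod (F w) \<le> exp (- (a q * mu \<gamma> w))" if "w \<in> S_set K (real (32 * p))" for w
      proof -
        have "cmod (F w) * exp (a q * mu \<gamma> w) \<le> 1"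
          using OV_seminorm_upper[OF F q(1), of w] that F1 by (simp add: q_def \<nu>_def exp_weights_def)
        then have "cmod (F w) * exp (a q * mu \<gamma> w) * exp (- (a q * mu \<gamma> w)) \<le> 1 * exp (- (a q * mu \<gamma> w))"
          by (intro mult_right_mono) auto
        then show ?thesis by (simp add: mult.assoc flip: exp_add)
      qed
      have Fh: "F holomorphic_on - finite_part K" "\<And>z. z \<in> finite_part K \<Longrightarrow> F z = 0"
        using F by (auto simp: OV_space_def)
      have ga: "grid_approx K p B \<Phi> F \<gamma> (a q) (J r)"
        using \<gamma> \<Phi> finJ[OF r] Fh(1) Fq by unfold_locales auto
      then interpret grid_approx K p B \<Phi> F \<gamma> "a q" N "J r" .
      have bdd: "bdd_above ((\<lambda>z. cmod (approx z) * \<nu> n' z) ` S_set K (real n'))" if n': "q \<le> n'" for n'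
      proof -
        obtain n'' C'' where "\<And>z. z \<in> S_set K (real n') \<Longrightarrow> cmod (approx z) * exp (a n' * mu \<gamma> z) \<le> C'' * r ^ n''"
          using bound[OF n'] r N(2) ga by blast
        then show ?thesis by (intro bdd_aboveI2) (auto simp: \<nu>_def exp_weights_def)
      qed
      have fOV: "approx \<in> OV_space K \<nu>"
        unfolding OV_space_def mem_Collect_eq
      proof (intro conjI ballI allI impI holomorphic_approx)
        show "approx z = 0" if "z \<in> finite_part K" for z using that by (simp add: approx_def)
        show "bdd_above ((\<lambda>z. cmod (approx z) * \<nu> n z) ` S_set K (real n))" if "1 \<le> n" for n
          unfolding \<nu>_def
          by (rule OV_bdd_above_of_large[where m = "mu \<gamma>", OF a mu_nonneg q(1) bdd[unfolded \<nu>_def] that])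
      qed
      have "OV_seminorm K \<nu> k approx \<le> C * r ^ n" if k: "1 \<le> k"
      proof -
        have "OV_seminorm K \<nu> k approx \<le> OV_seminorm K \<nu> m approx"
          using fOV k unfolding \<nu>_def by (intro OV_seminorm_mono[where m = "mu \<gamma>", OF a mu_nonneg]) (auto simp: m_def)
        also have "\<dots> \<le> C * r ^ n"
          using nC[OF r N(2) ga] k by (intro OV_seminorm_le) (auto simp: m_def \<nu>_def exp_weights_def)
        finally show ?thesis .
      qed
      moreover have "OV_seminorm K \<nu> p (\<lambda>z. F z - approx z) \<le> C0 / r"
      proof (rule OV_seminorm_le)
        fix z assume z: "z \<in> S_set K (real p)"
        have "(2 / 3) ^ N \<le> 1 / r"
        proof -
          have "(2 / 3 :: real) ^ N = 1 / (3 / 2) ^ N" by (simp add: power_divide)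
          also have "\<dots> \<le> 1 / r" using N(1) r by (intro frac_le) auto
          finally show ?thesis .
        qed
        then have "cmod (F z - approx z) * exp (a p * mu \<gamma> z)
            \<le> (4 * T + 5 * (wgt (a p) (T + real p) * exp \<delta> / \<delta>) * grid_sum_bound) / r"
          using r e outer[OF _ _ _ r] by (intro approx_error z) (auto simp: e_def)
        then show "cmod (F z - approx z) * \<nu> p z \<le> C0 / r"
          by (simp add: \<nu>_def exp_weights_def C0_def gsb_def grid_sum_bound_def)
      qed (use p2 in simp)
      ultimately show ?thesis using fOV by blast
    qed
    then show "\<exists>n C. C > 0 \<and> (\<forall>r\<ge>1. \<forall>F\<in>OV_space K \<nu>. OV_seminorm K \<nu> (32 * p) F \<le> 1 \<longrightarrow>
      (\<exists>f\<in>OV_space K \<nu>. (1 \<le> k \<longrightarrow> OV_seminorm K \<nu> k f \<le> C * r ^ n) \<and>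
         OV_seminorm K \<nu> p (\<lambda>z. F z - f z) \<le> C0 / r))"
      using C by blast
  qed
qed

theorem corollary4p4:
  fixes K :: "ereal set" and a :: "nat \<Rightarrow> real" and \<gamma> :: real
  assumes "compact K" and "K \<noteq> {}"
    and "strict_mono_on {1..} a"
    and "(\<forall>n\<ge>1. a n < 0) \<or> (\<forall>n\<ge>1. a n \<ge> 0)"
    and "a \<longlonglongrightarrow> 0 \<or> filterlim a at_top sequentially"
    and "0 < \<gamma>" and "\<gamma> \<le> 1"
    and "(K \<subseteq> range ereal \<or> (\<forall>x\<in>K \<inter> {\<infinity>, - \<infinity>}. \<not> x isolated_in K)) \<or>
         ((\<forall>n\<ge>1. a n < 0) \<and> a \<longlonglongrightarrow> 0 \<and> \<gamma> = 1)"
  shows "property_Omega (OV_space K (exp_weights a (mu \<gamma>)))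
           (OV_seminorm K (exp_weights a (mu \<gamma>)))"
  unfolding property_Omega_def
proof (intro allI impI)
  define \<nu> where "\<nu> = exp_weights a (mu \<gamma>)"
  let ?X = "OV_space K \<nu>" and ?s = "OV_seminorm K \<nu>"
  fix i :: nat assume i: "1 \<le> i"
  \<comment> \<open>The index 1 is exceptional in \<open>S_set\<close>, so the grid is built for an
    index of at least 2 and the estimate is passed down to \<open>i\<close> by monotonicity.\<close>
  define p where "p = max i 2"
  interpret strip_grid K p
    using assms(1) by unfold_locales (auto simp: p_def compact_imp_closed)
  have mono: "?s j F \<le> ?s k F" if "1 \<le> j" "j \<le> k" "F \<in> ?X" for j k F
    using that OV_seminorm_mono[where m = "mu \<gamma>", OF assms(3) mu_nonneg] unfolding \<nu>_def by blast
  obtain C0 where C0: "C0 > 0" and dec: "\<And>k. \<exists>n C. C > 0 \<and> (\<forall>r\<ge>1. \<forall>F\<in>?X. ?s (32 * p) F \<le> 1 \<longrightarrow>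
      (\<exists>f\<in>?X. (1 \<le> k \<longrightarrow> ?s k f \<le> C * r ^ n) \<and> ?s p (\<lambda>z. F z - f z) \<le> C0 / r))"
    using OV_decomposition[OF assms(3,6,7)] unfolding \<nu>_def by blast
  have ip: "i \<le> p" "1 \<le> p" by (auto simp: p_def)
  have "\<exists>n\<ge>1. \<exists>C>0. \<forall>r>0. seminorm_ball ?X ?s (32 * p)
      \<subseteq> {\<lambda>z. (C * r ^ n) *\<^sub>R f z + (1 / r) *\<^sub>R g z |f g. f \<in> seminorm_ball ?X ?s k \<and> g \<in> seminorm_ball ?X ?s i}"
    if k: "1 \<le> k" for k
  proof -
    obtain n C where C: "C > 0" and nC: "\<And>r F. 1 \<le> r \<Longrightarrow> F \<in> ?X \<Longrightarrow> ?s (32 * p) F \<le> 1 \<Longrightarrow>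
        \<exists>f\<in>?X. (1 \<le> k \<longrightarrow> ?s k f \<le> C * r ^ n) \<and> ?s p (\<lambda>z. F z - f z) \<le> C0 / r"
      using dec[of k] by blast
    \<comment> \<open>The decomposition is applied with c r instead of r: then C0/(c r) \<le> 1/r,
      and c \<ge> 1 keeps c r \<ge> 1.\<close>
    define c where "c = max 1 C0"
    have c: "1 \<le> c" "C0 \<le> c" by (auto simp: c_def)
    define C' where "C' = C * c ^ n"
    have C': "C' > 0" using C c by (simp add: C'_def)
    \<comment> \<open>The exponent is raised to \<open>Suc n\<close> because it has to be at least
      1. This is harmless: the power matters only for r \<ge> 1, since f is 0 otherwise.\<close>
    have "\<exists>f g. F = (\<lambda>z. (C' * r ^ Suc n) *\<^sub>R f z + (1 / r) *\<^sub>R g z) \<and> f \<in> seminorm_ball ?X ?s k \<and> g \<in> seminorm_ball ?X ?s i"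
      if r: "r > 0" and "F \<in> seminorm_ball ?X ?s (32 * p)" for r F
    proof -
      have F: "F \<in> ?X" "?s (32 * p) F \<le> 1" using that by (auto simp: seminorm_ball_def)
      show ?thesis
      proof (cases "1 \<le> r")
        case False
        \<comment> \<open>For r < 1 nothing has to be approximated: r F already lies in the ball for
          \<open>i\<close>, so all of F goes into the second summand.\<close>
        let ?f = "\<lambda>z. of_real 0 * F z" and ?g = "\<lambda>z. of_real r * F z"
        have eq: "F = (\<lambda>z. (C' * r ^ Suc n) *\<^sub>R ?f z + (1 / r) *\<^sub>R ?g z)"
          using r by (simp add: fun_eq_iff scaleR_conv_of_real)
        have "?f \<in> ?X" "?g \<in> ?X"
          using OV_space_scale F(1) unfolding \<nu>_def by blast+
        moreover have "?s k ?f \<le> 1"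
          using F(1) k unfolding \<nu>_def by (intro OV_seminorm_scale_le) auto
        moreover have "?s i ?g \<le> 1"
        proof -
          have "?s i F \<le> 1" using mono[OF i _ F(1), of "32 * p"] ip F(2) by simp
          then have "r * ?s i F \<le> r * 1" using r by (intro mult_left_mono) auto
          then have "r * ?s i F \<le> 1" using False by linarith
          then show ?thesis using F(1) i r False unfolding \<nu>_def by (intro OV_seminorm_scale_le) auto
        qed
        ultimately have balls: "?f \<in> seminorm_ball ?X ?s k" "?g \<in> seminorm_ball ?X ?s i"
          by (simp_all add: seminorm_ball_def)
        show ?thesis
        proof (intro exI conjI)
          show "F = (\<lambda>z. (C' * r ^ Suc n) *\<^sub>R ?f z + (1 / r) *\<^sub>R ?g z)" by (rule eq)
        qed (rule balls)+
      next
        case True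
        have cr: "1 \<le> c * r" using mult_mono[OF c(1) True] c True by simp
        obtain f where f: "f \<in> ?X" "?s k f \<le> C * (c * r) ^ n" "?s p (\<lambda>z. F z - f z) \<le> C0 / (c * r)"
          using nC[OF cr F] k by blast
        define c' where "c' = 1 / (C' * r ^ Suc n)"
        have c': "c' > 0" "c' * (C' * r ^ Suc n) = 1" using C' r by (auto simp: c'_def)
        let ?h = "\<lambda>z. F z - f z"
        let ?f = "\<lambda>z. of_real c' * f z" and ?g = "\<lambda>z. of_real r * ?h z"
        have h: "?h \<in> ?X"
          using OV_space_add_scale[of F K a "mu \<gamma>" f 1 "-1"] F(1) f(1) unfolding \<nu>_def by simp
        have eq: "F = (\<lambda>z. (C' * r ^ Suc n) *\<^sub>R ?f z + (1 / r) *\<^sub>R ?g z)"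
        proof
          fix z
          have "(C' * r ^ Suc n) *\<^sub>R ?f z = of_real (c' * (C' * r ^ Suc n)) * f z"
            by (simp only: scaleR_conv_of_real of_real_mult mult_ac)
          then have "(C' * r ^ Suc n) *\<^sub>R ?f z = f z" unfolding c'(2) by simp
          moreover have "(1 / r) *\<^sub>R ?g z = ?h z" using r by (simp add: scaleR_conv_of_real)
          ultimately show "F z = (C' * r ^ Suc n) *\<^sub>R ?f z + (1 / r) *\<^sub>R ?g z" by simp
        qed
        have "?f \<in> ?X" "?g \<in> ?X"
          using OV_space_scale f(1) h unfolding \<nu>_def by blast+
        moreover have "?s k ?f \<le> 1"
        proof -
          have "C * (c * r) ^ n = C' * r ^ n" by (simp add: C'_def power_mult_distrib)
          also have "\<dots> \<le> C' * r ^ Suc n" using True C' by (intro mult_left_mono power_increasing) auto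
          finally have "C * (c * r) ^ n \<le> C' * r ^ Suc n" .
          then have "c' * ?s k f \<le> c' * (C' * r ^ Suc n)"
            using f(2) c'(1) by (intro mult_left_mono) auto
          also have "\<dots> = 1" by (rule c'(2))
          finally show ?thesis using f(1) k c'(1) unfolding \<nu>_def by (intro OV_seminorm_scale_le) auto
        qed
        moreover have "?s i ?g \<le> 1"
        proof -
          have "?s i ?h \<le> C0 / (c * r)" using mono[OF i ip(1) h] f(3) by simp
          also have "\<dots> \<le> c / (c * r)" using c r by (intro divide_right_mono) auto
          finally have "?s i ?h \<le> 1 / r" using c by simp
          then have "r * ?s i ?h \<le> r * (1 / r)" using r by (intro mult_left_mono) auto
          then show ?thesis using h i r unfolding \<nu>_def by (intro OV_seminorm_scale_le) auto
        qed
        ultimately have balls: "?f \<in> seminorm_ball ?X ?s k" "?g \<in> seminorm_ball ?X ?s i"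
          by (simp_all add: seminorm_ball_def)
        show ?thesis
        proof (intro exI conjI)
          show "F = (\<lambda>z. (C' * r ^ Suc n) *\<^sub>R ?f z + (1 / r) *\<^sub>R ?g z)" by (rule eq)
        qed (rule balls)+
      qed
    qed
    then show ?thesis using C' by (intro exI[of _ "Suc n"] conjI exI[of _ C']) auto
  qed
  then show "\<exists>q\<ge>1. \<forall>k\<ge>1. \<exists>n\<ge>1. \<exists>C>0. \<forall>r>0. seminorm_ball (OV_space K (exp_weights a (mu \<gamma>))) (OV_seminorm K (exp_weights a (mu \<gamma>))) q
      \<subseteq> {\<lambda>z. (C * r ^ n) *\<^sub>R f z + (1 / r) *\<^sub>R g z |f g.
          f \<in> seminorm_ball (OV_space K (exp_weights a (mu \<gamma>))) (OV_seminorm K (exp_weights a (mu \<gamma>))) k \<and>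
          g \<in> seminorm_ball (OV_space K (exp_weights a (mu \<gamma>))) (OV_seminorm K (exp_weights a (mu \<gamma>))) i}"
    using ip unfolding \<nu>_def by (intro exI[of _ "32 * p"]) auto
qed

end
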